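(* Let $k = p_1p_2\cdots p_t \geq 6$ be even, where $p_1,\dots,p_t$ are primes, not necessarily distinct. Let $1 \leq i < t-1$, and suppose that at least one of $p_1,\dots,p_i$ equals $2$ and that $p_{i+1},\dots,p_t$ are odd primes. If $u \equiv 1 \pmod{p_1p_2\cdots p_i}$ and $g \equiv 0 \pmod{2p_{i+1}p_{i+2}\cdots p_t}$, then there exists a $k$-ARCS of $(K_u \times K_g)(2)$.
   Context: $u,g$ are positive integers. For graphs $G,H$, the tensor product $G \times H$ has vertex set $V(G)\times V(H)$, with $(g_1,h_1)$ adjacent to $(g_2,h_2)$ iff $g_1g_2 \in E(G)$ and $h_1h_2 \in E(H)$. For a graph $G$ and positive integer $\lambda$, $G(\lambda)$ is the multigraph obtained by replacing each edge of $G$ by $\lambda$ parallel edges. $K_n$ is the complete graph on $n$ vertices. $(K_u \times K_g)(\lambda)$ is regarded as a $u$-partite multigraph with partite sets $V_i = \{i\}\times V(K_g)$. A partial $C_k$-factor of $(K_u \times K_g)(\lambda)$ is a subgraph which, for some $i$, is a spanning subgraph of $(K_u \times K_g)(\lambda)\setminus V_i$ all of whose components are cycles of length $k$. A $k$-ARCS of $(K_u \times K_g)(\lambda)$ is a partition of its edge multiset into partial $C_k$-factors. *)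

theory Defs
  imports "HOL-Library.Multiset" "HOL-Number_Theory.Cong"
begin

record 'a graph =
  verts :: "'a set"
  edges :: "'a set set"

record 'a multigraph =
  mverts :: "'a set"
  medges :: "'a set multiset"

definition complete_graph :: "nat \<Rightarrow> nat graph" where
  "complete_graph n =
     \<lparr>verts = {..<n}, edges = {{x, y} | x y. x < n \<and> y < n \<and> x \<noteq> y}\<rparr>"

definition tensor_product :: "'a graph \<Rightarrow> 'b graph \<Rightarrow> ('a \<times> 'b) graph" where
  "tensor_product G H =
     \<lparr>verts = verts G \<times> verts H,
      edges = {{(g1, h1), (g2, h2)} | g1 h1 g2 h2. {g1, g2} \<in> edges G \<and> {h1, h2} \<in> edges H}\<rparr>"

text \<open>Parallel edges are recorded by multiplicity.  \<^const>\<open>mset_set\<close> is empty on infinite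
  sets, so this is meaningful for graphs with finitely many edges only.\<close>

definition multiply_edges :: "'a graph \<Rightarrow> nat \<Rightarrow> 'a multigraph" where
  "multiply_edges G lam =
     \<lparr>mverts = verts G, medges = repeat_mset lam (mset_set (edges G))\<rparr>"

definition induced_submultigraph :: "'a multigraph \<Rightarrow> 'a set \<Rightarrow> 'a multigraph" where
  "induced_submultigraph M W =
     \<lparr>mverts = mverts M \<inter> W, medges = filter_mset (\<lambda>e. e \<subseteq> W) (medges M)\<rparr>"

definition delete_vertices :: "'a multigraph \<Rightarrow> 'a set \<Rightarrow> 'a multigraph" where
  "delete_vertices M W = induced_submultigraph M (mverts M - W)"

definition submultigraph :: "'a multigraph \<Rightarrow> 'a multigraph \<Rightarrow> bool" where
  "submultigraph F M \<longleftrightarrow>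
     mverts F \<subseteq> mverts M \<and> medges F \<subseteq># medges M \<and> (\<forall>e\<in>#medges F. e \<subseteq> mverts F)"

definition spanning_submultigraph :: "'a multigraph \<Rightarrow> 'a multigraph \<Rightarrow> bool" where
  "spanning_submultigraph F M \<longleftrightarrow> submultigraph F M \<and> mverts F = mverts M"

definition adjacent :: "'a multigraph \<Rightarrow> 'a \<Rightarrow> 'a \<Rightarrow> bool" where
  "adjacent M x y \<longleftrightarrow> {x, y} \<in># medges M"

definition components :: "'a multigraph \<Rightarrow> 'a multigraph set" where
  "components M =
     (\<lambda>v. induced_submultigraph M {w \<in> mverts M. (adjacent M)\<^sup>*\<^sup>* v w}) ` mverts M"

definition is_cycle :: "nat \<Rightarrow> 'a multigraph \<Rightarrow> bool" where
  "is_cycle k C \<longleftrightarrow>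
     (\<exists>xs. distinct xs \<and> length xs = k \<and> mverts C = set xs \<and>
           medges C = image_mset (\<lambda>j. {xs ! j, xs ! (Suc j mod k)}) (mset_set {..<k}))"

definition tensor_multigraph :: "nat \<Rightarrow> nat \<Rightarrow> nat \<Rightarrow> (nat \<times> nat) multigraph" where
  "tensor_multigraph u g lam =
     multiply_edges (tensor_product (complete_graph u) (complete_graph g)) lam"

definition partite_set :: "nat \<Rightarrow> nat \<Rightarrow> (nat \<times> nat) set" where
  "partite_set g i = {i} \<times> verts (complete_graph g)"

definition partial_cycle_factor ::
  "nat \<Rightarrow> nat \<Rightarrow> nat \<Rightarrow> nat \<Rightarrow> (nat \<times> nat) multigraph \<Rightarrow> bool" where
  "partial_cycle_factor k u g lam F \<longleftrightarrow>
     (\<exists>i \<in> verts (complete_graph u).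
        spanning_submultigraph F (delete_vertices (tensor_multigraph u g lam) (partite_set g i)) \<and>
        (\<forall>C \<in> components F. is_cycle k C))"

text \<open>The factors form a multiset, because two of them may coincide as multigraphs
  (using different parallel copies of the same edges).\<close>

definition is_ARCS ::
  "nat \<Rightarrow> nat \<Rightarrow> nat \<Rightarrow> nat \<Rightarrow> (nat \<times> nat) multigraph multiset \<Rightarrow> bool" where
  "is_ARCS k u g lam Fs \<longleftrightarrow>
     (\<forall>F \<in># Fs. partial_cycle_factor k u g lam F) \<and>
     \<Sum>\<^sub># (image_mset medges Fs) = medges (tensor_multigraph u g lam)"

end

theory Submission
  imports Defs
begin

text \<open>
  Write \<open>k = m n\<close> with \<open>m = 2 a\<close> the product of the first \<open>i\<close> primes and \<open>n\<close> odd, so that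
  \<open>u = 2 a q + 1\<close> and \<open>n\<close> divides \<open>g\<close>.

  First, the complete digraph on \<open>u\<close> points decomposes into \<open>u\<close> factors, the one indexed by \<open>x\<close>
  consisting of directed \<open>m\<close>-cycles that cover all points but \<open>x\<close>.  For \<open>q = 1\<close> take the zigzag
  \<open>\<infinity>, 1, -1, 2, -2, ..., a\<close> over \<open>\<int>\<^sub>2\<^sub>a \<union> {\<infinity>}\<close>; for \<open>q = 2\<close> take a cycle \<open>C\<close> and its negative
  \<open>-C\<close> in \<open>\<int>\<^sub>4\<^sub>a\<^sub>+\<^sub>1\<close>, where \<open>C\<close> is a zigzag through \<open>1, ..., 2 a\<close> whose signs switch once.  Larger \<open>q\<close>
  reduce to smaller ones by filling the holes of a frame: if an odd \<open>v > 1\<close> divides \<open>q\<close>, the frame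
  comes from the matchings \<open>z \<mapsto> 2 y - z\<close> of \<open>\<int>\<^sub>v\<close>, and if \<open>4\<close> divides \<open>q\<close>, from the starter
  \<open>{1, 2}, {3, 6}, {5, 7}\<close> of \<open>\<int>\<^sub>8\<close> with holes \<open>{y, y + 4}\<close>.

  Secondly, every such \<open>m\<close>-cycle is lifted to the rows \<open>\<int>\<^sub>g\<close> by voltages that are alternately \<open>e\<close>
  and \<open>-e\<close>, except that one \<open>e\<close> is replaced by \<open>\<sigma> e\<close>, where \<open>\<sigma>\<close> permutes the nonzero residues and
  \<open>\<sigma> e - e\<close> always has order \<open>n\<close>.  The lifts are \<open>k\<close>-cycles, and they cover every ordered pair of
  adjacent vertices exactly once, hence every edge twice.
\<close>

section \<open>Cycle factors from permutations\<close>

text \<open>For \<open>k > 0\<close> bijectivity on \<open>W\<close> is implied, with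
  \<open>F ^^ (k - 1)\<close> as inverse; the last clause makes every orbit exactly \<open>k\<close>
  long.\<close>

definition cycle_permutation :: "nat \<Rightarrow> 'a set \<Rightarrow> ('a \<Rightarrow> 'a) \<Rightarrow> bool" where
  "cycle_permutation k W F \<longleftrightarrow>
     (\<forall>p\<in>W. F p \<in> W \<and> (F ^^ k) p = p \<and> (\<forall>j. 0 < j \<and> j < k \<longrightarrow> (F ^^ j) p \<noteq> p))"

text \<open>Edges are indexed by the points of \<open>W\<close>, so an orbit of length 2 carries a
  double edge, exactly as \<open>is_cycle\<close> counts it.\<close>

definition permutation_graph :: "'a set \<Rightarrow> ('a \<Rightarrow> 'a) \<Rightarrow> 'a multigraph" where
  "permutation_graph W F =
     \<lparr>mverts = W, medges = image_mset (\<lambda>p. {p, F p}) (mset_set W)\<rparr>"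

lemma funpow_closed:
  assumes "\<forall>p\<in>W. F p \<in> W" "p \<in> W"
  shows "(F ^^ j) p \<in> W"
  using assms by (induction j) auto

text \<open>The component of \<open>v\<close> is its orbit: an edge leads forwards along
  \<open>F\<close> or backwards, and going backwards amounts to applying \<open>F\<close> another
  \<open>k - 1\<close> times.\<close>

lemma components_permutation_graph:
  assumes cp: "cycle_permutation k W F" and k: "k > 0" and W: "finite W"
    and C: "C \<in> components (permutation_graph W F)"
  shows "is_cycle k C"
proof -
  let ?G = "permutation_graph W F"
  from C obtain v where v: "v \<in> W"
    and Ceq: "C = induced_submultigraph ?G {w \<in> W. (adjacent ?G)\<^sup>*\<^sup>* v w}"
    by (auto simp: components_def permutation_graph_def)
  have cl: "\<forall>p\<in>W. F p \<in> W" using cp by (auto simp: cycle_permutation_def)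
  have per: "(F ^^ k) p = p" if "p \<in> W" for p using cp that by (auto simp: cycle_permutation_def)
  define s where "s j = (F ^^ j) v" for j
  define Or where "Or = s ` {..<k}"
  have sW: "s j \<in> W" for j unfolding s_def using funpow_closed[OF cl v] .
  have smod: "s (j mod k) = s j" for j
    unfolding s_def by (rule funpow_mod_eq) (rule per[OF v])
  have sOr: "s j \<in> Or" for j
    unfolding Or_def using smod[of j] k by (metis imageI lessThan_iff mod_less_divisor)
  have sSuc: "F (s j) = s (Suc j)" for j by (simp add: s_def)
  have s0: "s 0 = v" by (simp add: s_def)
  have inj: "inj_on s {..<k}"
  proof (rule linorder_inj_onI)
    fix i j assume ij: "i < j" "i \<in> {..<k}" "j \<in> {..<k}"
    show "s i \<noteq> s j"
    proof
      assume "s i = s j"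
      then have "(F ^^ (j - i)) (s i) = s i"
        using ij funpow_add[of "j - i" i F] by (simp add: s_def)
      moreover have "0 < j - i" "j - i < k" using ij by auto
      ultimately show False using cp sW[of i] by (auto simp: cycle_permutation_def)
    qed
  qed auto
  have adj: "adjacent ?G p r \<longleftrightarrow> p \<in> W \<and> r \<in> W \<and> (r = F p \<or> p = F r)" for p r
    using cl W by (auto simp: adjacent_def permutation_graph_def doubleton_eq_iff)
  have pre: "p \<in> Or" if "p \<in> W" "F p \<in> Or" for p
  proof -
    from that obtain j where "F p = s j" by (auto simp: Or_def)
    then have "(F ^^ (k - 1)) (F p) = (F ^^ (k - 1)) (s j)" by simp
    moreover have "(F ^^ (k - 1)) (F p) = (F ^^ k) p"
      using k by (metis Suc_diff_1 comp_apply funpow_Suc_right)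
    moreover have "(F ^^ (k - 1)) (s j) = s (k - 1 + j)"
      by (simp add: s_def funpow_add)
    ultimately show ?thesis using per[OF that(1)] sOr by metis
  qed
  have reach: "{w \<in> W. (adjacent ?G)\<^sup>*\<^sup>* v w} = Or"
  proof (intro equalityI subsetI)
    fix w assume "w \<in> {w \<in> W. (adjacent ?G)\<^sup>*\<^sup>* v w}"
    then have "(adjacent ?G)\<^sup>*\<^sup>* v w" by auto
    then show "w \<in> Or"
    proof (induction rule: rtranclp_induct)
      case base then show ?case using sOr[of 0] s0 by simp
    next
      case (step y z)
      from step(3) obtain j where "y = s j" by (auto simp: Or_def)
      with step show ?case using adj pre sOr sSuc by metis
    qed
  next
    fix w assume "w \<in> Or"
    then obtain j where j: "w = s j" by (auto simp: Or_def)
    have "(adjacent ?G)\<^sup>*\<^sup>* v (s j)" for j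
    proof (induction j)
      case (Suc j)
      have "adjacent ?G (s j) (s (Suc j))" using adj sW sSuc by metis
      with Suc show ?case by auto
    qed (simp add: s0)
    then show "w \<in> {w \<in> W. (adjacent ?G)\<^sup>*\<^sup>* v w}" using j sW by auto
  qed
  have Ceq': "C = induced_submultigraph ?G Or" by (simp only: Ceq reach)
  have OrW: "Or \<subseteq> W" using sW by (auto simp: Or_def)
  have "medges C = filter_mset (\<lambda>e. e \<subseteq> Or) (image_mset (\<lambda>p. {p, F p}) (mset_set W))"
    by (simp add: Ceq' induced_submultigraph_def permutation_graph_def)
  also have "\<dots> = image_mset (\<lambda>p. {p, F p}) (filter_mset (\<lambda>p. {p, F p} \<subseteq> Or) (mset_set W))"
    by (simp add: filter_mset_image_mset)
  also have "filter_mset (\<lambda>p. {p, F p} \<subseteq> Or) (mset_set W) = mset_set {p \<in> W. {p, F p} \<subseteq> Or}"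
    using W by simp
  \<comment> \<open>The orbit is closed under \<open>F\<close>, so an edge lies inside it as soon as
    its tail does.\<close>
  also have "{p \<in> W. {p, F p} \<subseteq> Or} = Or"
    using OrW sOr sSuc by (auto simp: Or_def)
  also have "mset_set Or = image_mset s (mset_set {..<k})"
    unfolding Or_def using inj by (simp add: image_mset_mset_set)
  finally have E: "medges C = image_mset (\<lambda>j. {s j, s (Suc j)}) (mset_set {..<k})"
    by (simp add: multiset.map_comp o_def sSuc)
  define xs where "xs = map s [0..<k]"
  have "medges C = image_mset (\<lambda>j. {xs ! j, xs ! (Suc j mod k)}) (mset_set {..<k})"
    unfolding E by (rule image_mset_cong) (use k smod in \<open>auto simp: xs_def\<close>)
  moreover have "mverts C = set xs"
    using OrW by (auto simp: Ceq' induced_submultigraph_def permutation_graph_def xs_def Or_def)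
  moreover have "distinct xs" using inj by (simp add: xs_def distinct_map atLeast0LessThan)
  moreover have "length xs = k" by (simp add: xs_def)
  ultimately show ?thesis unfolding is_cycle_def by blast
qed

text \<open>An edge \<open>{p, r}\<close> comes from the two arcs \<open>(p, r)\<close> and
  \<open>(r, p)\<close>, which differ by irreflexivity. This is the source of the multiplicity
  2.\<close>

lemma image_mset_arcs:
  assumes fin: "finite A" and sym: "\<And>p r. (p, r) \<in> A \<Longrightarrow> (r, p) \<in> A"
    and irr: "\<And>p. (p, p) \<notin> A"
  shows "image_mset (\<lambda>(p, r). {p, r}) (mset_set A) =
         repeat_mset 2 (mset_set ((\<lambda>(p, r). {p, r}) ` A))"
proof (rule multiset_eqI)
  fix e
  let ?c = "\<lambda>(p, r). {p, r}"
  have c1: "count (image_mset ?c (mset_set A)) e = card {x \<in> A. ?c x = e}"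
    using fin by (simp add: count_image_mset') (simp add: conj_commute eq_commute)
  show "count (image_mset ?c (mset_set A)) e = count (repeat_mset 2 (mset_set (?c ` A))) e"
  proof (cases "e \<in> ?c ` A")
    case True
    then obtain p r where pr: "(p, r) \<in> A" "e = {p, r}" by auto
    then have "{x \<in> A. ?c x = e} = {(p, r), (r, p)}"
      using sym by (auto simp: doubleton_eq_iff)
    moreover have "p \<noteq> r" using pr irr by auto
    ultimately show ?thesis using c1 True fin by simp
  next
    case False
    then have "{x \<in> A. ?c x = e} = {}" by auto
    then show ?thesis using c1 False fin by simp
  qed
qed

text \<open>The factor of \<open>(x, e)\<close> avoids the partite set of \<open>x\<close>. All
  factors together traverse every ordered pair of adjacent vertices once, so forgetting directions
  uses every edge twice.\<close>

lemma is_ARCS_of_arc_decomposition: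
  fixes F :: "nat \<Rightarrow> nat \<Rightarrow> nat \<times> nat \<Rightarrow> nat \<times> nat"
  assumes k: "k > 0"
    and cp: "\<And>x e. x < u \<Longrightarrow> e \<in> {1..<g} \<Longrightarrow> cycle_permutation k (({..<u} - {x}) \<times> {..<g}) (F x e)"
    and arc: "bij_betw (\<lambda>((x, e), p). (p, F x e p))
        (SIGMA (x, e):{..<u} \<times> {1..<g}. ({..<u} - {x}) \<times> {..<g})
        {((y, r), (z, r')). y < u \<and> z < u \<and> y \<noteq> z \<and> r < g \<and> r' < g \<and> r \<noteq> r'}"
  shows "is_ARCS k u g 2
    (image_mset (\<lambda>(x, e). permutation_graph (({..<u} - {x}) \<times> {..<g}) (F x e))
      (mset_set ({..<u} \<times> {1..<g})))"
proof -
  let ?I = "{..<u} \<times> {1..<g}"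
  let ?W = "\<lambda>x. ({..<u} - {x}) \<times> {..<g}"
  let ?P = "\<lambda>(x, e). permutation_graph (?W x) (F x e)"
  let ?T = "SIGMA (x, e):?I. ?W x"
  let ?A = "{((y, r), (z, r')). y < u \<and> z < u \<and> y \<noteq> z \<and> r < g \<and> r' < g \<and> r \<noteq> r'}"
  have finA: "finite ?A"
    by (rule finite_subset[of _ "({..<u} \<times> {..<g}) \<times> ({..<u} \<times> {..<g})"]) auto
  have edges: "edges (tensor_product (complete_graph u) (complete_graph g)) = (\<lambda>(p, r). {p, r}) ` ?A"
    (is "?L = ?R")
  proof (intro equalityI subsetI)
    fix e assume "e \<in> ?L"
    then obtain y r z r' where "e = {(y, r), (z, r')}" "y < u" "z < u" "y \<noteq> z" "r < g" "r' < g" "r \<noteq> r'"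
      by (auto simp: tensor_product_def complete_graph_def doubleton_eq_iff)
    then show "e \<in> ?R" by (intro image_eqI[of _ _ "((y, r), (z, r'))"]) auto
  next
    fix e assume "e \<in> ?R"
    then obtain y r z r' where "e = {(y, r), (z, r')}" "y < u" "z < u" "y \<noteq> z" "r < g" "r' < g" "r \<noteq> r'"
      by auto
    moreover from this have "{y, z} \<in> edges (complete_graph u)" "{r, r'} \<in> edges (complete_graph g)"
      by (auto simp: complete_graph_def)
    ultimately show "e \<in> ?L"
      unfolding tensor_product_def by (simp only: graph.simps) blast
  qed
  have finT: "finite ?T" by auto
  have sum_T: "(\<Sum>i\<in>?I. image_mset (\<lambda>p. {p, F (fst i) (snd i) p}) (mset_set (?W (fst i)))) =
     image_mset (\<lambda>((x, e), p). {p, F x e p}) (mset_set ?T)"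
  proof (rule multiset_eqI)
    fix E
    have "count (\<Sum>i\<in>?I. image_mset (\<lambda>p. {p, F (fst i) (snd i) p}) (mset_set (?W (fst i)))) E
      = (\<Sum>i\<in>?I. card {p \<in> ?W (fst i). {p, F (fst i) (snd i) p} = E})"
      by (simp add: count_sum count_image_mset') (simp add: conj_commute eq_commute)
    also have "\<dots> = card (SIGMA i:?I. {p \<in> ?W (fst i). {p, F (fst i) (snd i) p} = E})"
      by (rule card_SigmaI[symmetric]) auto
    also have "(SIGMA i:?I. {p \<in> ?W (fst i). {p, F (fst i) (snd i) p} = E}) =
       {t \<in> ?T. (\<lambda>((x, e), p). {p, F x e p}) t = E}"
      by auto
    also have "card \<dots> = count (image_mset (\<lambda>((x, e), p). {p, F x e p}) (mset_set ?T)) E"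
      using finT by (simp add: count_image_mset') (simp add: conj_commute eq_commute)
    finally show "count (\<Sum>i\<in>?I. image_mset (\<lambda>p. {p, F (fst i) (snd i) p}) (mset_set (?W (fst i)))) E
      = count (image_mset (\<lambda>((x, e), p). {p, F x e p}) (mset_set ?T)) E" .
  qed
  have "\<Sum>\<^sub># (image_mset medges (image_mset ?P (mset_set ?I))) =
     (\<Sum>i\<in>?I. image_mset (\<lambda>p. {p, F (fst i) (snd i) p}) (mset_set (?W (fst i))))"
    by (simp add: multiset.map_comp o_def sum_unfold_sum_mset case_prod_unfold permutation_graph_def)
  also note sum_T
  also have "image_mset (\<lambda>((x, e), p). {p, F x e p}) (mset_set ?T) =
      image_mset (\<lambda>(p, r). {p, r}) (image_mset (\<lambda>((x, e), p). (p, F x e p)) (mset_set ?T))"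
    by (simp add: multiset.map_comp o_def case_prod_unfold)
  also have "image_mset (\<lambda>((x, e), p). (p, F x e p)) (mset_set ?T) = mset_set ?A"
    using arc by (subst image_mset_mset_set) (auto simp: bij_betw_def)
  also have "image_mset (\<lambda>(p, r). {p, r}) (mset_set ?A) = medges (tensor_multigraph u g 2)"
    using finA by (subst image_mset_arcs) (auto simp: tensor_multigraph_def multiply_edges_def edges)
  finally have total: "\<Sum>\<^sub># (image_mset medges (image_mset ?P (mset_set ?I))) = medges (tensor_multigraph u g 2)" .
  have "partial_cycle_factor k u g 2 (?P (x, e))" if x: "x < u" and e: "e \<in> {1..<g}" for x e
  proof -
    let ?G = "permutation_graph (?W x) (F x e)"
    have cl: "\<forall>p\<in>?W x. F x e p \<in> ?W x"
      using cp[OF x e] by (auto simp: cycle_permutation_def)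
    have mv: "mverts (delete_vertices (tensor_multigraph u g 2) (partite_set g x)) = ?W x"
      by (auto simp: delete_vertices_def induced_submultigraph_def tensor_multigraph_def
          multiply_edges_def tensor_product_def complete_graph_def partite_set_def)
    have mv': "mverts (tensor_multigraph u g 2) - partite_set g x = ?W x"
      by (auto simp: tensor_multigraph_def
          multiply_edges_def tensor_product_def complete_graph_def partite_set_def)
    have sub: "\<forall>E\<in>#medges ?G. E \<subseteq> ?W x"
      using cl by (auto simp: permutation_graph_def)
    \<comment> \<open>A factor is one summand of the total edge multiset, hence contained in
      it.\<close>
    have "medges ?G \<subseteq># \<Sum>\<^sub># (image_mset medges (image_mset ?P (mset_set ?I)))"
    proof -
      have "(x, e) \<in># mset_set ?I" using x e by simp
      then obtain M where "mset_set ?I = add_mset (x, e) M" by (metis insert_DiffM)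
      then show ?thesis by simp
    qed
    then have "medges ?G \<subseteq># medges (tensor_multigraph u g 2)" using total by simp
    then have "filter_mset (\<lambda>E. E \<subseteq> ?W x) (medges ?G) \<subseteq># filter_mset (\<lambda>E. E \<subseteq> ?W x) (medges (tensor_multigraph u g 2))"
      by (rule multiset_filter_mono)
    moreover have "filter_mset (\<lambda>E. E \<subseteq> ?W x) (medges ?G) = medges ?G"
      using sub by (simp add: filter_mset_eq_conv)
    ultimately have "submultigraph ?G (delete_vertices (tensor_multigraph u g 2) (partite_set g x))"
      using sub mv mv' unfolding submultigraph_def
      by (simp add: delete_vertices_def induced_submultigraph_def permutation_graph_def)
    then have "spanning_submultigraph ?G (delete_vertices (tensor_multigraph u g 2) (partite_set g x))"
      using mv by (simp add: spanning_submultigraph_def permutation_graph_def)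
    then show ?thesis
      using components_permutation_graph[OF cp[OF x e] k] x
      unfolding partial_cycle_factor_def by (auto simp: complete_graph_def)
  qed
  then have "\<forall>F\<in>#image_mset ?P (mset_set ?I). partial_cycle_factor k u g 2 F"
    by (simp only: set_image_mset finite_set_mset_mset_set finite_SigmaI finite_lessThan finite_atLeastLessThan)
      (simp only: ball_simps split_paired_Ball_Sigma, simp)
  with total show ?thesis unfolding is_ARCS_def by simp
qed

section \<open>Lifting near cycle systems\<close>

text \<open>The grading \<open>pos\<close> forces every cycle of \<open>f\<close> to have length exactly \<open>m\<close>, and it provides the
  positions at which the voltages are placed.\<close>

definition graded_cycles :: "nat \<Rightarrow> 'a set \<Rightarrow> ('a \<Rightarrow> 'a) \<Rightarrow> ('a \<Rightarrow> nat) \<Rightarrow> bool" where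
  "graded_cycles m W f pos \<longleftrightarrow>
     (\<forall>y\<in>W. f y \<in> W \<and> pos y < m \<and> pos (f y) = Suc (pos y) mod m \<and> (f ^^ m) y = y)"

text \<open>On a finite \<open>V\<close> the injectivity condition says that every ordered pair of distinct points
  is an arc \<open>(y, f x y)\<close> for exactly one \<open>x\<close>.\<close>

definition near_cycle_system :: "nat \<Rightarrow> 'a set \<Rightarrow> ('a \<Rightarrow> 'a \<Rightarrow> 'a) \<Rightarrow> bool" where
  "near_cycle_system m V f \<longleftrightarrow>
     (\<forall>x\<in>V. \<exists>pos. graded_cycles m (V - {x}) (f x) pos) \<and>
     (\<forall>y\<in>V. inj_on (\<lambda>x. f x y) (V - {y}))"

definition has_near_cycle_system :: "nat \<Rightarrow> nat \<Rightarrow> bool" where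
  "has_near_cycle_system m u \<longleftrightarrow> (\<exists>f. near_cycle_system m {..<u} f)"

section \<open>Iterates of graded cycles, cyclic sums and residues\<close>

lemma graded_cycles_funpow:
  assumes "graded_cycles m W f pos" "y \<in> W"
  shows "(f ^^ l) y \<in> W \<and> pos ((f ^^ l) y) = (pos y + l) mod m"
proof (induction l)
  case 0
  then show ?case using assms by (auto simp: graded_cycles_def)
next
  case (Suc l)
  then show ?case using assms by (auto simp: graded_cycles_def mod_Suc_eq)
qed

lemma graded_cycles_no_fixpoint:
  assumes "graded_cycles m W f pos" "y \<in> W" "m \<ge> 2"
  shows "f y \<noteq> y"
proof
  assume "f y = y"
  then have "Suc (pos y) mod m = pos y" "pos y < m" using assms by (auto simp: graded_cycles_def)
  then show False using assms(3) by (auto simp: mod_Suc split: if_splits)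
qed

lemma sum_lessThan_split:
  fixes v :: "nat \<Rightarrow> 'a::comm_monoid_add"
  shows "(\<Sum>l<A + B. v l) = (\<Sum>l<A. v l) + (\<Sum>l<B. v (A + l))"
  by (induction B) (simp_all add: add.assoc)

text \<open>Makes the total voltage of a cycle independent of the place where its traversal
  starts.\<close>

lemma sum_rotate:
  fixes v :: "nat \<Rightarrow> int"
  assumes "p < m"
  shows "(\<Sum>l<m. v ((p + l) mod m)) = (\<Sum>l<m. v l)"
proof (rule sum.reindex_bij_betw)
  have "inj_on (\<lambda>l. (p + l) mod m) {..<m}"
  proof (rule inj_onI)
    fix i j assume "i \<in> {..<m}" "j \<in> {..<m}" "(p + i) mod m = (p + j) mod m"
    then show "i = j" using nat_mod_eq_iff cong_add_lcancel_nat[of p i j m]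
      by (auto simp: cong_def)
  qed
  moreover have "(\<lambda>l. (p + l) mod m) ` {..<m} \<subseteq> {..<m}" using assms by auto
  ultimately show "bij_betw (\<lambda>l. (p + l) mod m) {..<m} {..<m}"
    by (simp add: bij_betw_def endo_inj_surj)
qed

lemma nat_mod_nonzero:
  assumes "g > 0" "c mod int g \<noteq> 0"
  shows "nat (c mod int g) \<in> {1..<g}"
proof -
  have "0 \<le> c mod int g" "c mod int g < int g" using assms by simp_all
  with assms(2) show ?thesis by auto
qed

lemma nat_mod_inject:
  assumes "g > 0"
  shows "nat (c mod int g) = nat (d mod int g) \<longleftrightarrow> c mod int g = d mod int g"
proof -
  have "0 \<le> c mod int g" "0 \<le> d mod int g" using assms by simp_all
  then show ?thesis by (rule eq_nat_nat_iff)
qed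

lemma nat_mod_eq_less_iff:
  assumes "r < g"
  shows "nat (c mod int g) = r \<longleftrightarrow> c mod int g = int r mod int g"
  using nat_mod_inject[of g c "int r"] assms by simp

text \<open>The shift by \<open>h\<close> on the residues modulo \<open>g\<close> with \<open>0\<close> cut out of its cycle: \<open>g - h\<close>, which
  would go to \<open>0\<close>, goes to \<open>h\<close>.  So the displacement is always \<open>h\<close> or \<open>2 h\<close>.\<close>

definition shift_skip :: "nat \<Rightarrow> nat \<Rightarrow> nat \<Rightarrow> nat" where
  "shift_skip g h e = (if e = g - h then h else (e + h) mod g)"

lemma shift_skip_eq:
  assumes "h < g" "e < g"
  shows "shift_skip g h e = (if e = g - h then h else if e + h < g then e + h else e + h - g)"
proof -
  have "(e + h) mod g = e + h - g" if "\<not> e + h < g"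
    using that assms by (subst le_mod_geq) auto
  then show ?thesis by (simp add: shift_skip_def)
qed

lemma shift_skip_mem:
  assumes "h > 0" "h < g" "e \<in> {1..<g}"
  shows "shift_skip g h e \<in> {1..<g}"
  using assms by (auto simp: shift_skip_eq)

lemma inj_on_shift_skip:
  assumes "h > 0" "h < g"
  shows "inj_on (shift_skip g h) {1..<g}"
  by (rule inj_onI) (use assms in \<open>auto simp: shift_skip_eq split: if_splits\<close>)

text \<open>Modulo \<open>g\<close> the displacement is \<open>h\<close> or \<open>2 * h\<close>. As
  \<open>g = n * h\<close> and 2 is invertible modulo the odd \<open>n\<close>, its additive order
  is \<open>n\<close> in both cases.\<close>

lemma multiple_shift_skip:
  assumes g: "g = n * h" "h > 0" and n: "odd n" "n > 1" and e: "e \<in> {1..<g}"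
  shows "int g dvd int l * (int (shift_skip g h e) - int e) \<longleftrightarrow> n dvd l"
proof -
  have hg: "h < g" using g n by simp
  obtain c :: int where c: "c = 1 \<or> c = 2" and "[int (shift_skip g h e) - int e = c * int h] (mod int g)"
  proof (cases "e = g - h")
    case True
    then show ?thesis using hg
      by (intro that[of 2]) (auto simp: shift_skip_def cong_iff_dvd_diff of_nat_diff)
  next
    case False
    then show ?thesis
      by (intro that[of 1]) (auto simp: shift_skip_def cong_def zmod_int mod_simps)
  qed
  then have "[int l * (int (shift_skip g h e) - int e) = int l * (c * int h)] (mod int g)"
    by (intro cong_mult cong_refl)
  then have "int g dvd int l * (int (shift_skip g h e) - int e) \<longleftrightarrow> int g dvd int l * (c * int h)"
    by (rule cong_dvd_iff)
  also have "\<dots> \<longleftrightarrow> int n dvd int l * c"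
    using g by (simp add: mult.assoc[symmetric])
  also have "\<dots> \<longleftrightarrow> int n dvd int l"
  proof -
    have "coprime (int n) c" using c n by (auto simp: coprime_right_2_iff_odd)
    then show ?thesis by (rule coprime_dvd_mult_left_iff)
  qed
  finally show ?thesis by simp
qed

text \<open>The total voltage round a base cycle has order \<open>n\<close>, so a lifted cycle
  closes after exactly \<open>n\<close> turns. An arc determines \<open>x\<close> through its base
  arc and then \<open>e\<close> through its row difference, since the voltages at a fixed position
  permute the nonzero residues.\<close>

lemma is_ARCS_of_near_cycle_system:
  fixes f :: "nat \<Rightarrow> nat \<Rightarrow> nat"
  assumes ncs: "near_cycle_system (2 * a) {..<u} f" and a: "a > 0"
    and n: "odd n" "n > 1" and g: "g = n * h" "h > 0"
  shows "\<exists>Fs. is_ARCS (2 * a * n) u g 2 Fs"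
proof -
  define m where "m = 2 * a"
  have m: "m \<ge> 2" using a by (simp add: m_def)
  have hg: "h < g" "g > 0" using g n by auto
  from ncs obtain pos where pos: "\<And>x. x < u \<Longrightarrow> graded_cycles m ({..<u} - {x}) (f x) (pos x)"
    unfolding near_cycle_system_def m_def by (metis lessThan_iff)
  \<comment> \<open>The signs cancel in pairs except at positions 0 and 1, which leave
    \<open>shift_skip g h e\<close> minus \<open>e\<close>.\<close>
  define vol :: "nat \<Rightarrow> nat \<Rightarrow> int" where
    "vol j e = (if j = 0 then int (shift_skip g h e) else if odd j then - int e else int e)" for j e
  define F where "F x e = (\<lambda>(y, r). (f x y, nat ((int r + vol (pos x y) e) mod int g)))" for x e
  have fW: "f x y < u \<and> f x y \<noteq> x \<and> f x y \<noteq> y" if "x < u" "y < u" "y \<noteq> x" for x y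
    using pos[OF that(1)] graded_cycles_no_fixpoint[OF pos[OF that(1)] _ m] that
    by (auto simp: graded_cycles_def)
  have surj: "(\<lambda>x. f x y) ` ({..<u} - {y}) = {..<u} - {y}" if "y < u" for y
  proof (rule endo_inj_surj)
    show "(\<lambda>x. f x y) ` ({..<u} - {y}) \<subseteq> {..<u} - {y}" using fW that by auto
  qed (use ncs that in \<open>auto simp: near_cycle_system_def\<close>)
  have vol_ne: "vol j e mod int g \<noteq> 0" if "e \<in> {1..<g}" for j e
  proof -
    have "\<not> int g dvd int e'" if "e' \<in> {1..<g}" for e' using that by (auto dest: nat_dvd_not_less)
    with that shift_skip_mem[OF g(2) hg(1) that] show ?thesis
      by (auto simp: vol_def mod_eq_0_iff_dvd)
  qed
  have vol_inj: "e = e'" if "e \<in> {1..<g}" "e' \<in> {1..<g}" "vol j e mod int g = vol j e' mod int g" for j e e'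
  proof -
    have *: "x = y" if "x \<in> {1..<g}" "y \<in> {1..<g}" "int x mod int g = int y mod int g" for x y
      using that by simp
    consider "j = 0" | "j \<noteq> 0" "odd j" | "j \<noteq> 0" "even j" by blast
    then show ?thesis
    proof cases
      case 1
      then have "shift_skip g h e = shift_skip g h e'"
        using that shift_skip_mem[OF g(2) hg(1)] by (intro *) (simp_all add: vol_def)
      then show ?thesis using that inj_on_shift_skip[OF g(2) hg(1)] by (auto dest: inj_onD)
    next
      case 2
      then have "(- int e) mod int g = (- int e') mod int g" using that(3) by (simp add: vol_def)
      then have "int e mod int g = int e' mod int g" by (metis mod_minus_cong minus_minus)
      then show ?thesis using * that by blast
    next
      case 3
      then have "int e mod int g = int e' mod int g" using that(3) by (simp add: vol_def)
      then show ?thesis using * that by blast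
    qed
  qed
  have vol_surj: "(\<lambda>e. nat (vol j e mod int g)) ` {1..<g} = {1..<g}" for j
  proof (rule endo_inj_surj)
    show "(\<lambda>e. nat (vol j e mod int g)) ` {1..<g} \<subseteq> {1..<g}"
    proof safe
      fix e assume "e \<in> {1..<g}"
      then show "nat (vol j e mod int g) \<in> {1..<g}"
        using vol_ne[of e j] hg by (intro nat_mod_nonzero)
    qed
    show "inj_on (\<lambda>e. nat (vol j e mod int g)) {1..<g}"
    proof (rule inj_onI)
      fix e e' assume *: "e \<in> {1..<g}" "e' \<in> {1..<g}" "nat (vol j e mod int g) = nat (vol j e' mod int g)"
      then have "vol j e mod int g = vol j e' mod int g" using nat_mod_inject[OF hg(2)] by blast
      then show "e = e'" using * vol_inj by blast
    qed
  qed auto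
  have vol_sum: "(\<Sum>l<m. vol l e) = int (shift_skip g h e) - int e" for e
  proof -
    have "(\<Sum>l<2 * Suc b. vol l e) = int (shift_skip g h e) - int e" for b
    proof (induction b)
      case 0
      then show ?case by (simp add: vol_def numeral_2_eq_2)
    next
      case (Suc b)
      have "(\<Sum>l<2 * Suc (Suc b). vol l e) = (\<Sum>l<2 * Suc b. vol l e) + vol (2 * Suc b) e + vol (Suc (2 * Suc b)) e"
        by simp
      then show ?case unfolding Suc by (simp add: vol_def)
    qed
    from this[of "a - 1"] show ?thesis using a by (simp add: m_def)
  qed
  have cp: "cycle_permutation (m * n) (({..<u} - {x}) \<times> {..<g}) (F x e)"
    if x: "x < u" and e: "e \<in> {1..<g}" for x e
    unfolding cycle_permutation_def
  proof (intro ballI)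
    fix p assume "p \<in> ({..<u} - {x}) \<times> {..<g}"
    then obtain y r where p: "p = (y, r)" and y: "y \<in> {..<u} - {x}" and r: "r < g" by auto
    note gr = pos[OF x]
    have it: "(F x e ^^ j) (y, r) =
        ((f x ^^ j) y, nat ((int r + (\<Sum>l<j. vol ((pos x y + l) mod m) e)) mod int g))" for j
    proof (induction j)
      case 0
      then show ?case using r by simp
    next
      case (Suc j)
      then show ?case using graded_cycles_funpow[OF gr y, of j] hg
        by (simp add: F_def mod_simps add.assoc)
    qed
    let ?w = "int (shift_skip g h e) - int e"
    have posy: "pos x y < m" and fm: "(f x ^^ m) y = y" using gr y by (auto simp: graded_cycles_def)
    have fm': "(f x ^^ (m * l)) y = y" for l
    proof -
      have "(f x ^^ (m * l mod m)) y = (f x ^^ (m * l)) y" using fm by (rule funpow_mod_eq)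
      then show ?thesis by simp
    qed
    have sumL: "(\<Sum>l<m * L. vol ((pos x y + l) mod m) e) = int L * ?w" for L
    proof (induction L)
      case (Suc L)
      have "(\<Sum>l<m * Suc L. vol ((pos x y + l) mod m) e) =
        (\<Sum>l<m * L. vol ((pos x y + l) mod m) e) + (\<Sum>l<m. vol ((pos x y + (m * L + l)) mod m) e)"
        using sum_lessThan_split[of "\<lambda>l. vol ((pos x y + l) mod m) e" "m * L" m]
        by (simp add: add.commute)
      also have "(\<Sum>l<m. vol ((pos x y + (m * L + l)) mod m) e) = (\<Sum>l<m. vol ((pos x y + l) mod m) e)"
        by (rule sum.cong) (auto simp: add.left_commute[of _ "m * L"])
      finally show ?case using Suc sum_rotate[OF posy, of "\<lambda>j. vol j e"] vol_sum
        by (simp add: algebra_simps)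
    qed simp
    have itL: "(F x e ^^ (m * L)) (y, r) = (y, nat ((int r + int L * ?w) mod int g))" for L
      by (simp only: it fm' sumL)
    have fixL: "(F x e ^^ (m * L)) (y, r) = (y, r) \<longleftrightarrow> n dvd L" for L
    proof -
      have "(F x e ^^ (m * L)) (y, r) = (y, r) \<longleftrightarrow> (int r + int L * ?w) mod int g = int r mod int g"
        using nat_mod_eq_less_iff[OF r] by (simp add: itL)
      also have "\<dots> \<longleftrightarrow> int g dvd int L * ?w"
        by (simp add: mod_eq_dvd_iff)
      finally show ?thesis using multiple_shift_skip[OF g n e] by simp
    qed
    have "F x e p \<in> ({..<u} - {x}) \<times> {..<g}"
      using y p hg fW[OF x, of y] by (auto simp: F_def nat_less_iff)
    moreover have "(F x e ^^ (m * n)) p = p" using fixL p by simp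
    moreover have "(F x e ^^ j) p \<noteq> p" if j: "0 < j" "j < m * n" for j
    proof
      assume *: "(F x e ^^ j) p = p"
      then have "(f x ^^ j) y = y" using it p by simp
      \<comment> \<open>The grading allows a return to \<open>y\<close> only after a multiple of
        \<open>m\<close> steps.\<close>
      then have "pos x y = (pos x y + j) mod m" using graded_cycles_funpow[OF gr y, of j] by simp
      then have "(pos x y + j) mod m = (pos x y + 0) mod m" using posy by simp
      then have "m dvd j" using cong_add_lcancel_nat[of "pos x y" j 0 m]
        by (simp add: cong_def mod_eq_0_iff_dvd)
      then obtain L where L: "j = m * L" by auto
      with * fixL p have "n dvd L" by simp
      then show False using j L m by (auto dest: dvd_imp_le)
    qed
    ultimately show "F x e p \<in> ({..<u} - {x}) \<times> {..<g} \<and> (F x e ^^ (m * n)) p = p \<and>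
      (\<forall>j. 0 < j \<and> j < m * n \<longrightarrow> (F x e ^^ j) p \<noteq> p)" by blast
  qed
  let ?T = "SIGMA (x, e):{..<u} \<times> {1..<g}. ({..<u} - {x}) \<times> {..<g}"
  let ?A = "{((y, r), (z, r')). y < u \<and> z < u \<and> y \<noteq> z \<and> r < g \<and> r' < g \<and> r \<noteq> r'}"
  \<comment> \<open>Separates an arc of the lift into its base arc and its row difference.\<close>
  have Fr: "F x e (y, r) = (z, r') \<longleftrightarrow> f x y = z \<and> vol (pos x y) e mod int g = (int r' - int r) mod int g"
    if "r < g" "r' < g" for x e y r z r'
  proof -
    have "nat ((int r + vol (pos x y) e) mod int g) = r' \<longleftrightarrow> (int r + vol (pos x y) e) mod int g = int r' mod int g"
      using nat_mod_eq_less_iff[OF that(2)] .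
    also have "\<dots> \<longleftrightarrow> vol (pos x y) e mod int g = (int r' - int r) mod int g"
      by (simp add: mod_eq_dvd_iff algebra_simps)
    finally show ?thesis by (auto simp: F_def)
  qed
  have "bij_betw (\<lambda>((x, e), p). (p, F x e p)) ?T ?A"
    unfolding bij_betw_def
  proof (intro conjI equalityI subsetI)
    show "inj_on (\<lambda>((x, e), p). (p, F x e p)) ?T"
    proof (rule inj_onI)
      fix s t
      assume sT: "s \<in> ?T" and tT: "t \<in> ?T"
        and eq: "(\<lambda>((x, e), p). (p, F x e p)) s = (\<lambda>((x, e), p). (p, F x e p)) t"
      obtain x e y r where s: "s = ((x, e), (y, r))" by (metis surj_pair)
      obtain x' e' y' r'' where t': "t = ((x', e'), (y', r''))" by (metis surj_pair)
      from eq s t' have t: "t = ((x', e'), (y, r))" and eq: "F x e (y, r) = F x' e' (y, r)" by auto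
      from sT tT s t have *: "x < u" "x' < u" "y < u" "r < g" "y \<noteq> x" "y \<noteq> x'" "e \<in> {1..<g}" "e' \<in> {1..<g}"
        by auto
      obtain z r' where zr: "F x e (y, r) = (z, r')" by (cases "F x e (y, r)")
      then have r': "r' < g" using hg by (auto simp: F_def nat_less_iff)
      have "f x y = f x' y" using zr eq Fr[OF \<open>r < g\<close> r'] by metis
      then have "x = x'" using ncs * unfolding near_cycle_system_def inj_on_def
        by (metis Diff_iff lessThan_iff singletonD)
      moreover have "vol (pos x y) e mod int g = vol (pos x' y) e' mod int g"
        using zr eq Fr[OF \<open>r < g\<close> r'] by metis
      ultimately show "s = t" using vol_inj[of e e' "pos x y"] * s t by auto
    qed
  next
    fix t assume "t \<in> (\<lambda>((x, e), p). (p, F x e p)) ` ?T"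
    then obtain s where sT: "s \<in> ?T" and ts: "t = (\<lambda>((x, e), p). (p, F x e p)) s" by blast
    obtain x e y r where s: "s = ((x, e), (y, r))" by (metis surj_pair)
    from sT ts s have *: "x < u" "y < u" "r < g" "y \<noteq> x" "e \<in> {1..<g}" "t = ((y, r), F x e (y, r))"
      by auto
    obtain z r' where zr: "F x e (y, r) = (z, r')" by (cases "F x e (y, r)")
    then have r': "r' < g" using hg by (auto simp: F_def nat_less_iff)
    have "r' \<noteq> r" using zr Fr[OF \<open>r < g\<close> r'] vol_ne[OF \<open>e \<in> _\<close>, of "pos x y"] by auto
    then show "t \<in> ?A" using * r' zr fW[of x y] Fr[OF \<open>r < g\<close> r'] by auto
  next
    fix t assume tA: "t \<in> ?A"
    obtain y r z r' where t: "t = ((y, r), (z, r'))" by (metis surj_pair)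
    from tA t have *: "y < u" "z < u" "y \<noteq> z" "r < g" "r' < g" "r \<noteq> r'" by auto
    then have "z \<in> (\<lambda>x. f x y) ` ({..<u} - {y})" using surj[of y] by auto
    then obtain x where x: "x < u" "x \<noteq> y" "f x y = z" by blast
    let ?d = "(int r' - int r) mod int g"
    have "?d \<noteq> 0" using * by (metis mod_0_imp_dvd mod_eq_dvd_iff mod_less of_nat_eq_iff of_nat_mod)
    then have "nat ?d \<in> {1..<g}" using hg by (intro nat_mod_nonzero)
    then obtain e where e: "e \<in> {1..<g}" "nat (vol (pos x y) e mod int g) = nat ?d"
      using vol_surj[of "pos x y"] by (metis (no_types, lifting) imageE)
    then have "F x e (y, r) = (z, r')" using Fr x * nat_mod_inject[OF hg(2)] by blast
    then show "t \<in> (\<lambda>((x, e), p). (p, F x e p)) ` ?T"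
      using x e * t by (intro image_eqI[of _ _ "((x, e), (y, r))"]) auto
  qed
  then show ?thesis
    using is_ARCS_of_arc_decomposition[of "m * n" u g F] cp m n unfolding m_def by auto
qed

section \<open>Near cycle systems by difference methods\<close>

lemma near_cycle_system_transfer:
  assumes ncs: "near_cycle_system m V f" and h: "bij_betw h V V'"
  shows "\<exists>f'. near_cycle_system m V' f'"
proof -
  define g where "g = inv_into V h"
  have gV: "g y \<in> V" and hg: "h (g y) = y" if "y \<in> V'" for y
    using h that unfolding g_def bij_betw_def by (auto simp: inv_into_into f_inv_into_f)
  have gh: "g (h y) = y" and hV: "h y \<in> V'" if "y \<in> V" for y
    using h that unfolding g_def bij_betw_def by auto
  define f' where "f' x y = h (f (g x) (g y))" for x y
  have "\<exists>pos. graded_cycles m (V' - {x}) (f' x) pos" if x: "x \<in> V'" for x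
  proof -
    obtain pos where pos: "graded_cycles m (V - {g x}) (f (g x)) pos"
      using ncs gV[OF x] by (auto simp: near_cycle_system_def)
    have gW: "g y \<in> V - {g x}" if "y \<in> V' - {x}" for y
      using that gV hg x by (metis DiffD1 DiffD2 DiffI singletonD singletonI)
    have hW: "h y \<in> V' - {x}" if "y \<in> V - {g x}" for y
      using that hV gh by (metis DiffD1 DiffD2 DiffI singletonD singletonI)
    have it: "(f' x ^^ l) y = h ((f (g x) ^^ l) (g y))" if y: "y \<in> V' - {x}" for l y
    proof (induction l)
      case 0
      then show ?case using hg y by simp
    next
      case (Suc l)
      have "(f (g x) ^^ l) (g y) \<in> V" using graded_cycles_funpow[OF pos gW[OF y]] by blast
      then show ?case using Suc gh by (simp add: f'_def)
    qed
    have "graded_cycles m (V' - {x}) (f' x) (\<lambda>y. pos (g y))"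
      unfolding graded_cycles_def
    proof (intro ballI)
      fix y assume y: "y \<in> V' - {x}"
      have *: "f (g x) (g y) \<in> V - {g x}" "pos (g y) < m" "pos (f (g x) (g y)) = Suc (pos (g y)) mod m"
        "(f (g x) ^^ m) (g y) = g y"
        using pos gW[OF y] unfolding graded_cycles_def by blast+
      show "f' x y \<in> V' - {x} \<and> pos (g y) < m \<and> pos (g (f' x y)) = Suc (pos (g y)) mod m \<and> (f' x ^^ m) y = y"
        using * hW[OF *(1)] it[OF y, of m] hg[of y] y gh[of "f (g x) (g y)"] by (simp add: f'_def)
    qed
    then show ?thesis by blast
  qed
  moreover have "inj_on (\<lambda>x. f' x y) (V' - {y})" if y: "y \<in> V'" for y
  proof (rule inj_onI)
    fix x x' assume *: "x \<in> V' - {y}" "x' \<in> V' - {y}" "f' x y = f' x' y"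
    have gxy: "g x \<in> V - {g y}" if "x \<in> V' - {y}" for x
      using that gV hg y by (metis DiffD1 DiffD2 DiffI singletonD singletonI)
    have fV: "f (g x) (g y) \<in> V" if "x \<in> V' - {y}" for x
      using ncs gxy[OF that] gV[OF y] unfolding near_cycle_system_def graded_cycles_def
      by (metis DiffD1 DiffD2 DiffI singletonD singletonI)
    have "f (g x) (g y) = f (g x') (g y)"
      using * fV gh unfolding f'_def by metis
    then have "g x = g x'"
      using ncs gV[OF y] gxy *(1,2) unfolding near_cycle_system_def by (meson inj_onD)
    then show "x = x'" using * hg by (metis DiffD1)
  qed
  ultimately show ?thesis unfolding near_cycle_system_def by blast
qed

text \<open>Allows each construction to work on whichever point set suits it.\<close>

lemma has_near_cycle_system_iff:
  assumes "finite V"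
  shows "has_near_cycle_system m (card V) \<longleftrightarrow> (\<exists>f. near_cycle_system m V f)"
proof -
  obtain h where h: "bij_betw h V {..<card V}"
    using ex_bij_betw_finite_nat[OF assms] by (auto simp: atLeast0LessThan)
  show ?thesis
    unfolding has_near_cycle_system_def
    using near_cycle_system_transfer[OF _ h] near_cycle_system_transfer[OF _ bij_betw_inv_into[OF h]]
    by metis
qed

text \<open>Here \<open>s x c j\<close> is the point at place \<open>j\<close> of cycle
  \<open>c\<close> in the factor of \<open>x\<close>. The count of points turns \<open>inj\<close>
  into covering all of \<open>V\<close> but \<open>x\<close>, and \<open>arc\<close> says that an
  arc determines its factor.\<close>

lemma has_near_cycle_system_of_cycles:
  fixes s :: "'a \<Rightarrow> 'c \<Rightarrow> nat \<Rightarrow> 'a"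
  assumes fin: "finite V" "finite C" and m: "m > 0" and card: "card V = card C * m + 1"
    and mem: "\<And>x c j. x \<in> V \<Longrightarrow> c \<in> C \<Longrightarrow> j < m \<Longrightarrow> s x c j \<in> V - {x}"
    and inj: "\<And>x c c' j j'. x \<in> V \<Longrightarrow> c \<in> C \<Longrightarrow> c' \<in> C \<Longrightarrow> j < m \<Longrightarrow> j' < m \<Longrightarrow>
      s x c j = s x c' j' \<Longrightarrow> c = c' \<and> j = j'"
    and arc: "\<And>x x' c c' j j'. x \<in> V \<Longrightarrow> x' \<in> V \<Longrightarrow> c \<in> C \<Longrightarrow> c' \<in> C \<Longrightarrow> j < m \<Longrightarrow> j' < m \<Longrightarrow>
      s x c j = s x' c' j' \<Longrightarrow> s x c (Suc j mod m) = s x' c' (Suc j' mod m) \<Longrightarrow> x = x'"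
  shows "has_near_cycle_system m (card V)"
proof -
  \<comment> \<open>Recovers the cycle and the place of a point; the place becomes the
    grading.\<close>
  define ix where "ix x y = inv_into (C \<times> {..<m}) (\<lambda>(c, j). s x c j) y" for x y
  define f where "f x y = s x (fst (ix x y)) (Suc (snd (ix x y)) mod m)" for x y
  have injx: "inj_on (\<lambda>(c, j). s x c j) (C \<times> {..<m})" if "x \<in> V" for x
    using inj[OF that] by (auto intro!: inj_onI)
  have ix: "ix x (s x c j) = (c, j)" if "x \<in> V" "c \<in> C" "j < m" for x c j
    using inv_into_f_f[OF injx[OF that(1)], of "(c, j)"] that by (simp add: ix_def)
  have fs: "f x (s x c j) = s x c (Suc j mod m)" if "x \<in> V" "c \<in> C" "j < m" for x c j
    using ix[OF that] by (simp add: f_def)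
  have cover: "\<exists>c\<in>C. \<exists>j<m. y = s x c j" if "x \<in> V" "y \<in> V - {x}" for x y
  proof -
    have "(\<lambda>(c, j). s x c j) ` (C \<times> {..<m}) = V - {x}"
    proof (rule card_subset_eq)
      show "card ((\<lambda>(c, j). s x c j) ` (C \<times> {..<m})) = card (V - {x})"
        using card_image[OF injx[OF that(1)]] that fin card by (simp add: card_cartesian_product)
    qed (use fin mem that in auto)
    then have "y \<in> (\<lambda>(c, j). s x c j) ` (C \<times> {..<m})" using that by simp
    then show ?thesis by auto
  qed
  have "\<exists>pos. graded_cycles m (V - {x}) (f x) pos" if x: "x \<in> V" for x
  proof -
    have it: "(f x ^^ l) (s x c j) = s x c ((j + l) mod m)" if "c \<in> C" "j < m" for l c j
    proof (induction l)
      case (Suc l)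
      then show ?case using fs[OF x \<open>c \<in> C\<close>, of "(j + l) mod m"] m by (simp add: mod_Suc_eq)
    qed (use that in simp)
    have "graded_cycles m (V - {x}) (f x) (\<lambda>y. snd (ix x y))"
      unfolding graded_cycles_def
    proof (intro ballI)
      fix y assume "y \<in> V - {x}"
      then obtain c j where cj: "c \<in> C" "j < m" "y = s x c j" using cover x by blast
      have "Suc j mod m < m" using m by simp
      then show "f x y \<in> V - {x} \<and> snd (ix x y) < m \<and> snd (ix x (f x y)) = Suc (snd (ix x y)) mod m \<and> (f x ^^ m) y = y"
        using cj x fs[OF x cj(1,2)] ix mem[OF x cj(1), of "Suc j mod m"] it by simp
    qed
    then show ?thesis by blast
  qed
  moreover have "inj_on (\<lambda>x. f x y) (V - {y})" if y: "y \<in> V" for y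
  proof (rule inj_onI)
    fix x x' assume *: "x \<in> V - {y}" "x' \<in> V - {y}" "f x y = f x' y"
    from * y obtain c j where cj: "c \<in> C" "j < m" "y = s x c j" using cover[of x y] by blast
    from * y obtain c' j' where cj': "c' \<in> C" "j' < m" "y = s x' c' j'" using cover[of x' y] by blast
    show "x = x'"
      using arc[of x x' c c' j j'] * cj cj' fs by (metis DiffD1)
  qed
  ultimately show ?thesis
    unfolding has_near_cycle_system_iff[OF fin(1)] near_cycle_system_def by blast
qed

section \<open>Base cases by explicit cycles of residues\<close>

lemma int_eq_if_dvd_diff:
  fixes x y d :: int
  assumes "d dvd x - y" "\<bar>x - y\<bar> < d"
  shows "x = y"
  using assms dvd_imp_le_int[of "x - y" d] by auto

text \<open>The factor of \<open>x\<close> consists of the digons on \<open>x + c\<close> and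
  \<open>x - c\<close>. The ends of its arcs sum to \<open>2 * x\<close>, which determines
  \<open>x\<close> because the modulus is odd.\<close>

lemma has_near_cycle_system_2: "has_near_cycle_system 2 (2 * q + 1)"
proof -
  define u where "u = 2 * int q + 1"
  let ?V = "{0..<u}"
  let ?C = "{1..int q}"
  define s where "s x c j = (x + (if j = 0 then c else - c)) mod u" for x c :: int and j :: nat
  have card: "card ?V = 2 * q + 1" by (simp add: u_def nat_add_distrib nat_mult_distrib)
  have "has_near_cycle_system 2 (card ?V)"
  proof (rule has_near_cycle_system_of_cycles[where C = ?C and s = s])
    show "card ?V = card ?C * 2 + 1" using card by simp
  next
    fix x c and j :: nat assume *: "x \<in> ?V" "c \<in> ?C" "j < 2"
    have "s x c j \<noteq> x"
    proof
      assume "s x c j = x"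
      then have "s x c j = x mod u" using * by simp
      then have "u dvd (if j = 0 then c else - c)" by (simp add: s_def mod_eq_dvd_iff)
      then have "u dvd c - 0" by (simp split: if_splits)
      then show False using int_eq_if_dvd_diff[of u c 0] * by (auto simp: u_def)
    qed
    moreover have "u > 0" by (simp add: u_def)
    ultimately show "s x c j \<in> ?V - {x}" by (simp add: s_def)
  next
    fix x c c' and j j' :: nat
    assume *: "x \<in> ?V" "c \<in> ?C" "c' \<in> ?C" "j < 2" "j' < 2" "s x c j = s x c' j'"
    have "(if j = 0 then c else - c) = (if j' = 0 then c' else - c')"
    proof (rule int_eq_if_dvd_diff)
      show "u dvd (if j = 0 then c else - c) - (if j' = 0 then c' else - c')"
        using *(6) unfolding s_def mod_eq_dvd_iff by (simp only: add_diff_cancel_left)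
    qed (use * in \<open>auto simp: u_def\<close>)
    then show "c = c' \<and> j = j'" using * by (auto split: if_splits)
  next
    fix x x' c c' and j j' :: nat
    assume *: "x \<in> ?V" "x' \<in> ?V" "j < 2" "j' < 2" "s x c j = s x' c' j'"
      "s x c (Suc j mod 2) = s x' c' (Suc j' mod 2)"
    have sm: "(s x c j + s x c (Suc j mod 2)) mod u = (2 * x) mod u" if "j < 2" for x c and j :: nat
      using that by (cases "j = 0") (auto simp: s_def mod_simps less_2_cases_iff)
    have "(2 * x) mod u = (2 * x') mod u" using sm[OF *(3), of x c] sm[OF *(4), of x' c'] *(5,6) by simp
    then have "u dvd (x - x') * 2" by (simp add: mod_eq_dvd_iff algebra_simps)
    moreover have "coprime u 2" by (simp add: u_def)
    ultimately have "u dvd x - x'" using coprime_dvd_mult_left_iff by blast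
    then show "x = x'" using * by (intro int_eq_if_dvd_diff) auto
  qed auto
  then show ?thesis using card by simp
qed

definition zigzag :: "nat \<Rightarrow> int" where
  "zigzag j = (if even j then int (j div 2) + 1 else - int (Suc j div 2))"

text \<open>The steps -2, 3, -4, 5, ... for \<open>j < 2 * a - 2\<close> are, modulo
  \<open>2 * a\<close>, all residues except 0 and 1, once each.\<close>

lemma zigzag_Suc: "zigzag (Suc j) - zigzag j = (if even j then - (int j + 2) else int j + 2)"
  by (auto simp: zigzag_def elim!: evenE oddE)

lemma zigzag_bounds:
  assumes "j < 2 * a - 1"
  shows "zigzag j \<noteq> 0 \<and> - int a < zigzag j \<and> zigzag j \<le> int a"
  using assms by (auto simp: zigzag_def elim!: evenE oddE)

lemma zigzag_inj: "zigzag j = zigzag j' \<Longrightarrow> j = j'"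
  by (auto simp: zigzag_def split: if_splits elim!: evenE oddE)

text \<open>The factor of \<open>Some t\<close> is the zigzag translated by \<open>t\<close> and
  closed up through \<open>None\<close>; its steps use every difference but 0 and 1. The factor of
  \<open>None\<close> is the cycle 0, 1, 2, ..., which supplies the difference 1.\<close>

lemma has_near_cycle_system_base_1:
  assumes a: "a > 0"
  shows "has_near_cycle_system (2 * a) (2 * a + 1)"
proof -
  define d where "d = 2 * int a"
  have d: "d > 0" "even d" using a by (auto simp: d_def)
  let ?V = "insert None (Some ` {0..<d})"
  let ?C = "{()}"
  define s :: "int option \<Rightarrow> unit \<Rightarrow> nat \<Rightarrow> int option" where
    "s x c j = (case x of None \<Rightarrow> Some (int j)
       | Some t \<Rightarrow> if j = 2 * a - 1 then None else Some ((t + zigzag j) mod d))" for x c j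
  have card: "card ?V = 2 * a + 1"
    by (subst card_insert_disjoint) (auto simp: card_image d_def)
  \<comment> \<open>As \<open>d\<close> is even, a step congruent to 1 is odd, hence equal to
    \<open>j + 2\<close>; then \<open>d\<close> would divide \<open>j + 1\<close>, which lies
    strictly between 0 and \<open>d\<close>.\<close>
  have no1: "\<not> d dvd (zigzag (Suc j) - zigzag j) - 1" if "Suc j < 2 * a - 1" for j
  proof
    assume dv: "d dvd (zigzag (Suc j) - zigzag j) - 1"
    then have "even ((zigzag (Suc j) - zigzag j) - 1)" using d(2) by (rule dvd_trans[rotated])
    then have "odd j" by (auto simp: zigzag_Suc split: if_splits)
    then have "d dvd int j + 1 - 0" using dv by (simp add: zigzag_Suc algebra_simps)
    moreover have "int j + 1 < d" using that unfolding d_def by linarith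
    ultimately show False using int_eq_if_dvd_diff[of d "int j + 1" 0] by simp
  qed
  have step_inj: "j = j'" if "Suc j < 2 * a" "Suc j' < 2 * a"
      "d dvd (zigzag (Suc j) - zigzag j) - (zigzag (Suc j') - zigzag j')" for j j'
  proof -
    have "even ((zigzag (Suc j) - zigzag j) - (zigzag (Suc j') - zigzag j'))"
      using d(2) that(3) by (rule dvd_trans)
    then have "even j \<longleftrightarrow> even j'" by (auto simp: zigzag_Suc split: if_splits)
    then have "d dvd int j - int j'"
      using that(3) dvd_minus_iff[of d "int j - int j'"] by (auto simp: zigzag_Suc split: if_splits)
    then show ?thesis using int_eq_if_dvd_diff[of d "int j" "int j'"] that by (auto simp: d_def)
  qed
  \<comment> \<open>An arc of the factor of \<open>None\<close> avoids \<open>None\<close> and has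
    difference 1, which no zigzag step has.\<close>
  have NS: False if "j < 2 * a" "j' < 2 * a" "s None c j = s (Some t) c' j'"
      "s None c (Suc j mod (2 * a)) = s (Some t) c' (Suc j' mod (2 * a))" for c c' j j' t
  proof -
    have j': "j' < 2 * a - 1" using that by (auto simp: s_def split: if_splits)
    then have Sj': "Suc j' mod (2 * a) = Suc j'" by simp
    then have j'2: "Suc j' < 2 * a - 1" using that(4) j' by (auto simp: s_def split: if_splits)
    have e1: "int j mod d = (t + zigzag j') mod d"
      using that(1,3) j' by (auto simp: s_def d_def)
    have e2: "(int j + 1) mod d = (t + zigzag (Suc j')) mod d"
      using that(4) j'2 Sj' by (auto simp: s_def d_def zmod_int add.commute)
    have "d dvd (int j + 1 - (t + zigzag (Suc j'))) - (int j - (t + zigzag j'))"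
      using e1 e2 unfolding mod_eq_dvd_iff by (blast intro: dvd_diff)
    then have "d dvd - ((zigzag (Suc j') - zigzag j') - 1)" by (simp add: algebra_simps)
    then show False using no1[OF j'2] by (simp only: dvd_minus_iff)
  qed
  have "has_near_cycle_system (2 * a) (card ?V)"
  proof (rule has_near_cycle_system_of_cycles[where C = ?C and s = s])
    show "card ?V = card ?C * (2 * a) + 1" using card by simp
  next
    fix x c j assume *: "x \<in> ?V" "c \<in> ?C" "j < 2 * a"
    show "s x c j \<in> ?V - {x}"
    proof (cases x)
      case None
      then show ?thesis using * by (auto simp: s_def d_def)
    next
      case (Some t)
      have "(t + zigzag j) mod d \<noteq> t" if "j \<noteq> 2 * a - 1"
      proof
        assume "(t + zigzag j) mod d = t"
        then have "(t + zigzag j) mod d = t mod d" using * Some by auto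
        then have "d dvd zigzag j - 0" by (simp add: mod_eq_dvd_iff)
        moreover have "j < 2 * a - 1" using *(3) that by linarith
        then have "zigzag j \<noteq> 0" "\<bar>zigzag j - 0\<bar> < d" using zigzag_bounds[of j a] by (auto simp: d_def)
        ultimately show False using int_eq_if_dvd_diff by blast
      qed
      then show ?thesis using Some d by (auto simp: s_def)
    qed
  next
    fix x c c' j j'
    assume *: "x \<in> ?V" "j < 2 * a" "j' < 2 * a" "s x c j = s x c' j'"
    show "c = c' \<and> j = j'"
    proof (cases x)
      case None
      then show ?thesis using * by (auto simp: s_def)
    next
      case (Some t)
      show ?thesis
      proof (cases "j = 2 * a - 1 \<or> j' = 2 * a - 1")
        case True
        then show ?thesis using * Some by (auto simp: s_def split: if_splits)
      next
        case False
        then have "(t + zigzag j) mod d = (t + zigzag j') mod d" using * Some by (simp add: s_def)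
        then have "d dvd zigzag j - zigzag j'" by (simp add: mod_eq_dvd_iff)
        moreover have "j < 2 * a - 1" "j' < 2 * a - 1" using *(2,3) False by linarith+
        then have "\<bar>zigzag j - zigzag j'\<bar> < d"
          using zigzag_bounds[of j a] zigzag_bounds[of j' a] by (auto simp: d_def)
        ultimately have "zigzag j = zigzag j'" by (rule int_eq_if_dvd_diff)
        then show ?thesis using zigzag_inj by simp
      qed
    qed
  next
    fix x x' c c' j j'
    assume *: "x \<in> ?V" "x' \<in> ?V" "j < 2 * a" "j' < 2 * a" "s x c j = s x' c' j'"
      "s x c (Suc j mod (2 * a)) = s x' c' (Suc j' mod (2 * a))"
    show "x = x'"
    proof (cases "x = None \<or> x' = None")
      case True
      then show ?thesis using * NS by (cases x; cases x') (auto, metis)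
    next
      case False
      then obtain t t' where t: "x = Some t" "x' = Some t'" by auto
      have same: "t = t'" if "i < 2 * a - 1" "(t + zigzag i) mod d = (t' + zigzag i) mod d" for i
      proof (rule int_eq_if_dvd_diff)
        show "d dvd t - t'" using that by (simp add: mod_eq_dvd_iff)
      qed (use * t in auto)
      \<comment> \<open>The arc leaves \<open>None\<close>, enters \<open>None\<close>, or joins two
        residues. In the first two cases its other end gives \<open>t\<close>; in the third its
        difference gives the place \<open>j\<close> first.\<close>
      consider "j = 2 * a - 1" | "j < 2 * a - 1" "Suc j = 2 * a - 1" | "Suc j < 2 * a - 1"
        using *(3) by linarith
      then show ?thesis
      proof cases
        case 1
        then have j': "j' = 2 * a - 1" using * t by (auto simp: s_def split: if_splits)
        have "Suc (2 * a - 1) mod (2 * a) = 0" using a by simp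
        then have "s x c 0 = s x' c' 0" using *(6) 1 j' by simp
        moreover have "0 < 2 * a - 1" using a by simp
        ultimately show ?thesis using same[of 0] t by (auto simp: s_def)
      next
        case 2
        then have "j' < 2 * a - 1" using * t by (auto simp: s_def split: if_splits)
        then have "j' = j" using *(6) 2 t by (auto simp: s_def split: if_splits)
        then show ?thesis using same[of j] *(5) 2 t by (auto simp: s_def)
      next
        case 3
        then have j': "j' < 2 * a - 1" using * t by (auto simp: s_def split: if_splits)
        then have j'2: "Suc j' < 2 * a - 1" using *(6) 3 t by (auto simp: s_def split: if_splits)
        have e1: "(t + zigzag j) mod d = (t' + zigzag j') mod d"
          using *(5) 3 j' t by (auto simp: s_def)
        have e2: "(t + zigzag (Suc j)) mod d = (t' + zigzag (Suc j')) mod d"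
          using *(6) 3 j'2 t by (auto simp: s_def)
        have "d dvd (t + zigzag (Suc j) - (t' + zigzag (Suc j'))) - (t + zigzag j - (t' + zigzag j'))"
          using e1 e2 unfolding mod_eq_dvd_iff by (blast intro: dvd_diff)
        then have "d dvd (zigzag (Suc j) - zigzag j) - (zigzag (Suc j') - zigzag j')"
          by (simp add: algebra_simps)
        then have "j = j'" using 3 j'2 by (intro step_inj) auto
        then show ?thesis using same[of j] e1 3 t by auto
      qed
    qed
  qed (use a in auto)
  then show ?thesis using card by simp
qed

text \<open>The factor of \<open>x\<close> has the cycles \<open>x + z\<close> and
  \<open>x - z\<close>. The values of \<open>z\<close> with their negatives, and likewise the cyclic
  differences of \<open>z\<close> with theirs, run once through the nonzero residues, so an arc
  determines its cycle, its place and hence \<open>x\<close>.\<close>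

lemma has_near_cycle_system_base_2:
  assumes a: "a \<ge> 2"
  shows "has_near_cycle_system (2 * a) (4 * a + 1)"
proof -
  define u where "u = 4 * int a + 1"
  let ?V = "{0..<u}"
  let ?C = "{1, - 1} :: int set"
  \<comment> \<open>This \<open>J\<close> is odd, so that the terms of \<open>w\<close> on either
    side of the switch add up to \<open>2 * a + 1\<close>; its size makes the closing difference
    \<open>w 0 + w (2 * a - 1)\<close> congruent to \<open>2 * a - J\<close> up to sign.\<close>
  define J where "J = (if odd a then a - 2 else a - 1)"
  define w :: "nat \<Rightarrow> int" where
    "w j = (if odd a then (if even j then int (j div 2) + 1 else 2 * int a - int (j div 2))
            else (if even j then 2 * int a - int (j div 2) else int (j div 2) + 1))" for j
  \<comment> \<open>Consecutive terms of \<open>w\<close> differ by \<open>2 a - 1, ..., 1\<close>.  The sign switch at \<open>J\<close> turns one of these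
    into a sum, which is \<open>2 a + 1\<close>; the lost difference \<open>2 a - J\<close> is recovered on closing the cycle.\<close>
  define z where "z j = (if j < J then w j else - w j)" for j
  define s where "s x c j = (x + c * z j) mod u" for x c :: int and j :: nat
  define D where "D j = z (Suc j mod (2 * a)) - z j" for j
  \<comment> \<open>The cyclic differences of \<open>z\<close> modulo \<open>u\<close>, up to sign.
    At the switch, \<open>2 * a\<close> stands for the sum \<open>2 * a + 1\<close>, being congruent
    to its negative.\<close>
  define kap :: "nat \<Rightarrow> int" where
    "kap j = (if Suc j = J then 2 * int a else if Suc j = 2 * a then 2 * int a - int J
              else 2 * int a - 1 - int j)" for j
  have card: "card ?V = 4 * a + 1" by (simp add: u_def nat_add_distrib nat_mult_distrib)
  have u: "u > 0" by (simp add: u_def)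
  have J: "1 \<le> J" "J < a" using a by (auto simp: J_def elim: oddE)
  have w_bounds: "1 \<le> w j \<and> w j \<le> 2 * int a" if "j < 2 * a" for j
    using that by (auto simp: w_def)
  have w_inj: "j = j'" if "j < 2 * a" "j' < 2 * a" "w j = w j'" for j j'
    using that by (auto simp: w_def split: if_splits elim!: evenE oddE)
  have w_step: "w (Suc j) - w j = 2 * int a - 1 - int j \<or> w (Suc j) - w j = - (2 * int a - 1 - int j)" for j
    by (cases "odd a"; cases "even j") (auto simp: w_def elim!: evenE oddE)
  have w_pair: "w (Suc j) + w j = 2 * int a + 1" if "even j" for j
    using that by (auto simp: w_def elim!: evenE)
  have evenJ: "even j" if "Suc j = J" for j
    using that a by (cases "odd a") (auto simp: J_def elim!: evenE oddE, presburger+)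
  have w_last: "w 0 + w (2 * a - 1) = (if odd a then int a + 2 else 3 * int a)"
    using a by (auto simp: w_def elim!: evenE oddE)
  have kap_bounds: "1 \<le> kap j \<and> kap j \<le> 2 * int a" if "j < 2 * a" for j
    using that J by (auto simp: kap_def)
  have kap_inj: "j = j'" if "j < 2 * a" "j' < 2 * a" "kap j = kap j'" for j j'
    using that J by (auto simp: kap_def split: if_splits)
  have "\<exists>t. (t = 1 \<or> t = - 1) \<and> u dvd D j - t * kap j" if j: "j < 2 * a" for j
  proof -
    consider "Suc j < J" | "Suc j = J" | "J \<le> j" "Suc j < 2 * a" | "Suc j = 2 * a"
      using j by linarith
    then show ?thesis
    proof cases
      case 1
      then have "D j = w (Suc j) - w j" "kap j = 2 * int a - 1 - int j" using J by (auto simp: D_def z_def kap_def)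
      then show ?thesis using w_step[of j] by (metis diff_self dvd_0_right mult_1 mult_minus_left)
    next
      case 2
      then have "D j = - (w (Suc j) + w j)" "kap j = 2 * int a" using J by (auto simp: D_def z_def kap_def)
      then have "D j - 1 * kap j = - u" using w_pair[OF evenJ[OF 2]] by (simp add: u_def)
      then show ?thesis by (metis dvd_minus_iff dvd_refl)
    next
      case 3
      then have "D j = - (w (Suc j) - w j)" "kap j = 2 * int a - 1 - int j" using J by (auto simp: D_def z_def kap_def)
      then show ?thesis using w_step[of j] by (metis diff_self dvd_0_right mult_1 mult_minus_left minus_minus)
    next
      case 4
      then have j: "j = 2 * a - 1" by simp
      have Dj: "D j = w 0 + w (2 * a - 1)" "kap j = 2 * int a - int J" using J j a by (auto simp: D_def z_def kap_def)
      show ?thesis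
      proof (cases "odd a")
        case True
        then have "D j - 1 * kap j = 0" using Dj w_last a by (simp add: J_def of_nat_diff)
        then show ?thesis by (metis dvd_0_right)
      next
        case False
        then have "D j - (- 1) * kap j = u" using Dj w_last a by (simp add: J_def of_nat_diff u_def)
        then show ?thesis by (metis dvd_refl)
      qed
    qed
  qed
  then obtain tau where tau: "\<And>j. j < 2 * a \<Longrightarrow> tau j = 1 \<or> tau j = - 1"
      "\<And>j. j < 2 * a \<Longrightarrow> u dvd D j - tau j * kap j" by metis
  have "has_near_cycle_system (2 * a) (card ?V)"
  proof (rule has_near_cycle_system_of_cycles[where C = ?C and s = s])
    show "card ?V = card ?C * (2 * a) + 1" using card by simp
  next
    fix x c j assume *: "x \<in> ?V" "c \<in> ?C" "j < 2 * a"
    have "s x c j \<noteq> x"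
    proof
      assume "s x c j = x"
      then have "s x c j = x mod u" using * by simp
      then have "u dvd c * z j - 0" by (simp add: s_def mod_eq_dvd_iff)
      moreover have "\<bar>c * z j - 0\<bar> < u" "c * z j \<noteq> 0"
        using *(2) w_bounds[OF *(3)] by (auto simp: z_def u_def)
      ultimately show False using int_eq_if_dvd_diff by blast
    qed
    then show "s x c j \<in> ?V - {x}" using u by (simp add: s_def)
  next
    fix x c c' j j'
    assume *: "x \<in> ?V" "c \<in> ?C" "c' \<in> ?C" "j < 2 * a" "j' < 2 * a" "s x c j = s x c' j'"
    have eq: "c * z j = c' * z j'"
    proof (rule int_eq_if_dvd_diff)
      show "u dvd c * z j - c' * z j'"
        using *(6) unfolding s_def mod_eq_dvd_iff by (simp only: add_diff_cancel_left)
      show "\<bar>c * z j - c' * z j'\<bar> < u"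
        using *(2,3) w_bounds[OF *(4)] w_bounds[OF *(5)] by (auto simp: z_def u_def)
    qed
    then have "\<bar>c * z j\<bar> = \<bar>c' * z j'\<bar>" by simp
    then have "w j = w j'"
      using *(2,3) w_bounds[OF *(4)] w_bounds[OF *(5)] by (auto simp: z_def split: if_splits)
    then have "j = j'" using w_inj * by blast
    moreover have "z j \<noteq> 0" using w_bounds[OF *(4)] by (auto simp: z_def)
    ultimately show "c = c' \<and> j = j'" using eq by simp
  next
    fix x x' c c' j j'
    assume *: "x \<in> ?V" "x' \<in> ?V" "c \<in> ?C" "c' \<in> ?C" "j < 2 * a" "j' < 2 * a" "s x c j = s x' c' j'"
      "s x c (Suc j mod (2 * a)) = s x' c' (Suc j' mod (2 * a))"
    have "u dvd ((x + c * z (Suc j mod (2 * a))) - (x' + c' * z (Suc j' mod (2 * a)))) -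
        ((x + c * z j) - (x' + c' * z j'))"
      using *(7,8) unfolding s_def mod_eq_dvd_iff by (blast intro: dvd_diff)
    then have "u dvd c * D j - c' * D j'" by (simp add: D_def algebra_simps)
    moreover have "u dvd c * (D j - tau j * kap j)" "u dvd c' * (D j' - tau j' * kap j')"
      using tau(2) *(5,6) by simp_all
    ultimately have "u dvd (c * D j - c' * D j') - (c * (D j - tau j * kap j) - c' * (D j' - tau j' * kap j'))"
      by (blast intro: dvd_diff)
    then have "u dvd c * tau j * kap j - c' * tau j' * kap j'" by (simp add: algebra_simps)
    moreover have "\<bar>c * tau j * kap j - c' * tau j' * kap j'\<bar> < u"
      using *(3,4) tau(1)[OF *(5)] tau(1)[OF *(6)] kap_bounds[OF *(5)] kap_bounds[OF *(6)]
      by (auto simp: u_def)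
    ultimately have eq: "c * tau j * kap j = c' * tau j' * kap j'" by (rule int_eq_if_dvd_diff)
    then have "\<bar>c * tau j * kap j\<bar> = \<bar>c' * tau j' * kap j'\<bar>" by simp
    then have "kap j = kap j'"
      using *(3,4) tau(1)[OF *(5)] tau(1)[OF *(6)] kap_bounds[OF *(5)] kap_bounds[OF *(6)]
      by auto
    then have jj: "j = j'" using kap_inj * by blast
    then have "c = c'" using eq tau(1)[OF *(5)] kap_bounds[OF *(5)] by auto
    then have "u dvd x - x'" using *(7) jj by (simp add: s_def mod_eq_dvd_iff)
    then show "x = x'" using *(1,2) by (intro int_eq_if_dvd_diff) auto
  qed (use a in auto)
  then show ?thesis using card by simp
qed

section \<open>Frames\<close>

lemma graded_cycles_cong:
  assumes "graded_cycles m W f pos" "\<And>y. y \<in> W \<Longrightarrow> f' y = f y"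
  shows "graded_cycles m W f' pos"
proof -
  have "(f' ^^ l) y = (f ^^ l) y" if "y \<in> W" for l y
  proof (induction l)
    case (Suc l)
    then show ?case using graded_cycles_funpow[OF assms(1) that, of l] assms(2) by simp
  qed simp
  then show ?thesis using assms unfolding graded_cycles_def by simp
qed

text \<open>The pieces can be graded independently, because \<open>ky\<close> recovers the piece of
  a point and \<open>f\<close> never leaves it.\<close>

lemma graded_cycles_UN:
  assumes "\<And>i. i \<in> I \<Longrightarrow> graded_cycles m (W i) f (pos i)"
    and "\<And>i y. i \<in> I \<Longrightarrow> y \<in> W i \<Longrightarrow> ky y = i"
  shows "graded_cycles m (\<Union>i\<in>I. W i) f (\<lambda>y. pos (ky y) y)"
  unfolding graded_cycles_def
proof (intro ballI)
  fix y assume "y \<in> (\<Union>i\<in>I. W i)"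
  then obtain i where i: "i \<in> I" "y \<in> W i" by blast
  then have fy: "f y \<in> W i" using assms(1) by (auto simp: graded_cycles_def)
  then have "ky y = i" "ky (f y) = i" using assms(2) i by auto
  then show "f y \<in> (\<Union>i\<in>I. W i) \<and> pos (ky y) y < m \<and>
      pos (ky (f y)) (f y) = Suc (pos (ky y) y) mod m \<and> (f ^^ m) y = y"
    using assms(1)[OF i(1)] i fy by (auto simp: graded_cycles_def)
qed

lemma near_cycle_system_graded:
  "near_cycle_system m V f \<Longrightarrow> x \<in> V \<Longrightarrow> \<exists>pos. graded_cycles m (V - {x}) (f x) pos"
  by (simp add: near_cycle_system_def)

lemma near_cycle_system_inject:
  assumes "near_cycle_system m V f" "x \<in> V" "x' \<in> V" "p \<in> V" "x \<noteq> p" "x' \<noteq> p" "f x p = f x' p"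
  shows "x = x'"
proof -
  have "inj_on (\<lambda>x. f x p) (V - {p})" using assms by (simp add: near_cycle_system_def)
  then show ?thesis by (rule inj_onD) (use assms in auto)
qed

lemma near_cycle_system_mem:
  assumes "near_cycle_system m V f" "m \<ge> 2" "x \<in> V" "p \<in> V" "p \<noteq> x"
  shows "f x p \<in> V \<and> f x p \<noteq> x \<and> f x p \<noteq> p"
proof -
  obtain pos where pos: "graded_cycles m (V - {x}) (f x) pos"
    using near_cycle_system_graded[OF assms(1,3)] by blast
  have p: "p \<in> V - {x}" using assms by simp
  have "f x p \<in> V - {x}" using pos p by (simp add: graded_cycles_def)
  then show ?thesis using graded_cycles_no_fixpoint[OF pos p assms(2)] by simp
qed

text \<open>On the pair of blocks over \<open>z\<close> and \<open>M z\<close> the second coordinates satisfy \<open>c + c' = b\<close>, and the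
  third ones satisfy \<open>i + i' = e\<close> and \<open>i + i' = e + 1\<close> alternately, so two steps advance \<open>i\<close> by one.\<close>

definition pair_step :: "(nat \<Rightarrow> nat) \<Rightarrow> int \<Rightarrow> int \<Rightarrow> int \<Rightarrow> int \<Rightarrow> nat \<times> int \<times> int \<Rightarrow> nat \<times> int \<times> int" where
  "pair_step M w b a e = (\<lambda>(z, c, i). (M z, (b - c) mod w, (if z < M z then e - i else e + 1 - i) mod a))"

lemma graded_cycles_pair_step:
  fixes M :: "nat \<Rightarrow> nat"
  assumes a: "a > 0" and w: "w > 0"
    and M: "\<And>z. z \<in> Z \<Longrightarrow> M z \<in> Z \<and> M z \<noteq> z \<and> M (M z) = z"
  shows "\<exists>pos. graded_cycles (2 * a) (Z \<times> {0..<int w} \<times> {0..<int a}) (pair_step M (int w) b (int a) e) pos"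
proof -
  let ?f = "pair_step M (int w) b (int a) e"
  let ?W = "Z \<times> {0..<int w} \<times> {0..<int a}"
  \<comment> \<open>Even positions lie over the smaller index of a pair and odd ones over the
    larger, where \<open>e - i\<close> recovers the coordinate of the preceding point.\<close>
  define pos :: "nat \<times> int \<times> int \<Rightarrow> nat" where
    "pos = (\<lambda>(z, c, i). if z < M z then 2 * nat i else 2 * nat ((e - i) mod int a) + 1)"
  have two: "(?f ^^ (2 * l)) (z, c, i) = (z, c, (i + int l) mod int a)"
    if z: "z \<in> Z" "z < M z" and ci: "c \<in> {0..<int w}" "i \<in> {0..<int a}" for z c i l
  proof (induction l)
    case 0
    then show ?case using ci by simp
  next
    case (Suc l)
    have "(?f ^^ (2 * Suc l)) (z, c, i) = ?f (?f ((?f ^^ (2 * l)) (z, c, i)))" by simp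
    also have "\<dots> = (z, c, (i + int (Suc l)) mod int a)"
      unfolding Suc using M[OF z(1)] z(2) ci by (simp add: pair_step_def mod_simps algebra_simps)
    finally show ?case .
  qed
  have period: "(?f ^^ (2 * a)) (z, c, i) = (z, c, i)"
    if z: "z \<in> Z" and ci: "c \<in> {0..<int w}" "i \<in> {0..<int a}" for z c i
  proof (cases "z < M z")
    case True
    then show ?thesis using two[OF z True ci, of a] ci by simp
  next
    case False
    then have lt: "M z < M (M z)" using M[OF z] by simp
    \<comment> \<open>A point over the larger index is the image of \<open>p\<close>, which lies
      over the smaller one, and inherits its period.\<close>
    define p where "p = (M z, (b - c) mod int w, (e - i) mod int a)"
    have fp: "?f p = (z, c, i)"
      using M[OF z] lt ci by (simp add: p_def pair_step_def mod_simps)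
    have "(?f ^^ (2 * a)) p = p"
      using two[of "M z" "(b - c) mod int w" "(e - i) mod int a" a] M[OF z] lt a w
      by (simp add: p_def)
    then have "(?f ^^ (2 * a)) (?f p) = ?f p" by (simp add: funpow_swap1[symmetric])
    then show ?thesis using fp by simp
  qed
  have "graded_cycles (2 * a) ?W ?f pos"
    unfolding graded_cycles_def
  proof (intro ballI)
    fix p assume "p \<in> ?W"
    then obtain z c i where p: "p = (z, c, i)" and z: "z \<in> Z"
      and ci: "c \<in> {0..<int w}" "i \<in> {0..<int a}" by auto
    have "pos (?f p) = Suc (pos p) mod (2 * a)"
    proof (cases "z < M z")
      case True
      then have "pos (?f p) = 2 * nat i + 1"
        using M[OF z] ci by (simp add: p pos_def pair_step_def mod_simps)
      moreover have "2 * nat i + 1 < 2 * a" using ci by auto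
      ultimately show ?thesis using True by (simp add: p pos_def)
    next
      case False
      let ?j = "(e - i) mod int a"
      have j: "0 \<le> ?j" "?j < int a" using a by simp_all
      have lt: "M z < z" using False M[OF z] by auto
      then have "pos (?f p) = 2 * nat ((e + 1 - i) mod int a)"
        using M[OF z] by (simp add: p pos_def pair_step_def)
      also have "(e + 1 - i) mod int a = (?j + 1) mod int a" by (simp add: mod_simps algebra_simps)
      also have "nat ((?j + 1) mod int a) = Suc (nat ?j) mod a"
        using j by (simp add: nat_mod_distrib nat_add_distrib)
      also have "2 * (Suc (nat ?j) mod a) = Suc (pos p) mod (2 * a)"
        using False by (simp add: p pos_def mult_mod_right)
      finally show ?thesis .
    qed
    moreover have "pos p < 2 * a"
    proof -
      have "nat ((e - i) mod int a) < a" using a by (simp add: nat_less_iff)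
      then show ?thesis using ci by (auto simp: p pos_def)
    qed
    moreover have "?f p \<in> ?W" using M[OF z] a w by (simp add: p pair_step_def)
    ultimately show "?f p \<in> ?W \<and> pos p < 2 * a \<and> pos (?f p) = Suc (pos p) mod (2 * a) \<and> (?f ^^ (2 * a)) p = p"
      using period[OF z ci] p by simp
  qed
  then show ?thesis by blast
qed

lemma graded_cycles_Some:
  assumes "graded_cycles m W f pos"
  shows "graded_cycles m (Some ` W) (map_option f) (\<lambda>y. pos (the y))"
proof -
  have "(map_option f ^^ l) (Some y) = Some ((f ^^ l) y)" for l y
    by (induction l) auto
  then show ?thesis using assms by (auto simp: graded_cycles_def)
qed

text \<open>For \<open>y\<close> in \<open>U\<close>, the involution \<open>M y\<close> is a perfect matching of the points outside the hole of
  \<open>y\<close>; by \<open>M_inj\<close> each pair of points in different holes is matched by exactly one \<open>y\<close>.\<close>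

lemma has_near_cycle_system_frame:
  fixes U :: "nat set" and hole :: "nat \<Rightarrow> nat" and M :: "nat \<Rightarrow> nat \<Rightarrow> nat"
  assumes a: "a > 0" and w: "w > 0" and U: "finite U"
    and M: "\<And>y z. y \<in> U \<Longrightarrow> z \<in> U \<Longrightarrow> hole z \<noteq> hole y \<Longrightarrow>
        M y z \<in> U \<and> hole (M y z) \<noteq> hole y \<and> hole (M y z) \<noteq> hole z \<and> M y (M y z) = z"
    and M_inj: "\<And>y y' z. y \<in> U \<Longrightarrow> y' \<in> U \<Longrightarrow> z \<in> U \<Longrightarrow> hole y \<noteq> hole z \<Longrightarrow> hole y' \<noteq> hole z \<Longrightarrow>
        M y z = M y' z \<Longrightarrow> y = y'"
    and card: "\<And>y. y \<in> U \<Longrightarrow> card {z \<in> U. hole z = hole y} = k"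
    and fill: "has_near_cycle_system (2 * a) (k * w * a + 1)"
  shows "has_near_cycle_system (2 * a) (card U * w * a + 1)"
proof -
  let ?B = "{0..<int w} \<times> {0..<int a}"
  let ?V = "insert None (Some ` (U \<times> ?B))"
  define H where "H t = {z \<in> U. hole z = t}" for t
  \<comment> \<open>Every hole receives the same extra point \<open>None\<close>, the summand 1 in
    the sizes.\<close>
  define Vo where "Vo t = insert None (Some ` (H t \<times> ?B))" for t
  have m: "2 * a \<ge> 2" using a by simp
  have cardV: "card (insert None (Some ` (X \<times> ?B))) = card X * w * a + 1" if "finite X" for X :: "nat set"
    using that by (subst card_insert_disjoint) (auto simp: card_image card_cartesian_product)
  have "\<exists>G. near_cycle_system (2 * a) (Vo t) G" if "t \<in> hole ` U" for t
  proof -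
    from that have "card (H t) = k" using card by (auto simp: H_def)
    then have "card (Vo t) = k * w * a + 1" using cardV[of "H t"] U by (simp add: Vo_def H_def)
    moreover have "finite (Vo t)" using U by (simp add: Vo_def H_def)
    ultimately show ?thesis using fill has_near_cycle_system_iff[of "Vo t" "2 * a"] by simp
  qed
  then obtain G where G: "\<And>t. t \<in> hole ` U \<Longrightarrow> near_cycle_system (2 * a) (Vo t) (G t)" by metis
  define ho :: "(nat \<times> int \<times> int) option \<Rightarrow> nat" where "ho p = hole (fst (the p))" for p
  \<comment> \<open>The factor of \<open>None\<close> joins the \<open>None\<close> factors of all
    fillings. The factor of a point over \<open>y\<close> follows the filling on the hole of
    \<open>y\<close> and the matched pairs of blocks elsewhere.\<close>
  define f where "f x p =
     (case x of None \<Rightarrow> G (ho p) None p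
      | Some (y, b, e) \<Rightarrow> if p = None \<or> ho p = hole y then G (hole y) x p
          else map_option (pair_step (M y) (int w) b (int a) e) p)" for x p
  note Ggr = near_cycle_system_graded[OF G]
  note Gmem = near_cycle_system_mem[OF G m]
  note Ginj = near_cycle_system_inject[OF G]
  have VoSome: "Some q \<in> Vo t \<longleftrightarrow> q \<in> U \<times> ?B \<and> hole (fst q) = t" for q t
    by (cases q) (auto simp: Vo_def H_def)
  have VoNone: "None \<in> Vo t" for t by (simp add: Vo_def)
  have "\<exists>pos. graded_cycles (2 * a) (?V - {x}) (f x) pos" if x: "x \<in> ?V" for x
  proof (cases x)
    case None
    have "\<exists>pos. graded_cycles (2 * a) (Vo t - {None}) (f None) pos" if t: "t \<in> hole ` U" for t
    proof -
      obtain pos where "graded_cycles (2 * a) (Vo t - {None}) (G t None) pos"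
        using Ggr[OF t VoNone] by blast
      then have "graded_cycles (2 * a) (Vo t - {None}) (f None) pos"
        by (rule graded_cycles_cong) (auto simp: f_def ho_def Vo_def H_def)
      then show ?thesis by blast
    qed
    then obtain pos where "\<And>t. t \<in> hole ` U \<Longrightarrow> graded_cycles (2 * a) (Vo t - {None}) (f None) (pos t)" by metis
    then have "graded_cycles (2 * a) (\<Union>t\<in>hole ` U. Vo t - {None}) (f None) (\<lambda>p. pos (ho p) p)"
      by (rule graded_cycles_UN) (auto simp: ho_def Vo_def H_def)
    moreover have "(\<Union>t\<in>hole ` U. Vo t - {None}) = ?V - {None}"
      by (auto simp: Vo_def H_def)
    ultimately show ?thesis using None by auto
  next
    case (Some q)
    then obtain y b e where xq: "x = Some (y, b, e)" by (cases q) auto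
    with x have y: "y \<in> U" and be: "(b, e) \<in> ?B" by auto
    have oy: "hole y \<in> hole ` U" using y by simp
    have xV: "x \<in> Vo (hole y)" using xq y be VoSome by simp
    obtain pos1 where "graded_cycles (2 * a) (Vo (hole y) - {x}) (G (hole y) x) pos1"
      using Ggr[OF oy xV] by blast
    then have g1: "graded_cycles (2 * a) (Vo (hole y) - {x}) (f x) pos1"
      by (rule graded_cycles_cong) (auto simp: xq f_def ho_def Vo_def H_def)
    let ?Z = "U - H (hole y)"
    obtain pos where "graded_cycles (2 * a) (?Z \<times> ?B) (pair_step (M y) (int w) b (int a) e) pos"
    proof -
      have "M y z \<in> ?Z \<and> M y z \<noteq> z \<and> M y (M y z) = z" if "z \<in> ?Z" for z
        using M[OF y, of z] that by (auto simp: H_def)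
      then show ?thesis using graded_cycles_pair_step[OF a w] that by blast
    qed
    from graded_cycles_Some[OF this]
    have g2: "graded_cycles (2 * a) (Some ` (?Z \<times> ?B)) (f x) (\<lambda>p. pos (the p))"
      by (rule graded_cycles_cong) (auto simp: xq f_def ho_def H_def)
    have "graded_cycles (2 * a) (\<Union>i\<in>{True, False}. if i then Vo (hole y) - {x} else Some ` (?Z \<times> ?B)) (f x)
       (\<lambda>p. (if p = None \<or> ho p = hole y then pos1 else (\<lambda>p. pos (the p))) p)"
      by (rule graded_cycles_UN[where ky = "\<lambda>p. p = None \<or> ho p = hole y"
            and pos = "\<lambda>i. if i then pos1 else (\<lambda>p. pos (the p))"])
        (use g1 g2 in \<open>auto simp: ho_def Vo_def H_def split: if_splits\<close>)
    moreover have "(\<Union>i\<in>{True, False}. if i then Vo (hole y) - {x} else Some ` (?Z \<times> ?B)) = ?V - {x}"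
      using y by (auto simp: xq Vo_def H_def)
    ultimately show ?thesis by auto
  qed
  moreover have "inj_on (\<lambda>x. f x p) (?V - {p})" if p: "p \<in> ?V" for p
  proof (cases p)
    case None
    show ?thesis
    proof (rule inj_onI)
      fix x x' assume *: "x \<in> ?V - {p}" "x' \<in> ?V - {p}" "f x p = f x' p"
      \<comment> \<open>An arc out of \<open>None\<close> stays in the hole of \<open>x\<close>, so
        its target reveals that hole, and the filling there reveals \<open>x\<close>.\<close>
      have fx: "ho x \<in> hole ` U \<and> x \<in> Vo (ho x) \<and> f x p = G (ho x) x p \<and> ho (f x p) = ho x" if "x \<in> ?V - {p}" for x
      proof -
        from that None obtain y b e where xq: "x = Some (y, b, e)" "y \<in> U" "(b, e) \<in> ?B" by auto
        then have 1: "ho x \<in> hole ` U" "x \<in> Vo (ho x)" "f x p = G (ho x) x p"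
          using VoSome[of "(y, b, e)" "hole y"] None by (simp_all add: ho_def f_def)
        have "G (ho x) x p \<in> Vo (ho x) \<and> G (ho x) x p \<noteq> None"
          using Gmem[OF 1(1,2) VoNone] xq(1) None by simp
        then obtain r where "f x p = Some r" "Some r \<in> Vo (ho x)" using 1(3) by (cases "f x p") auto
        then have "ho (f x p) = ho x" using VoSome[of r "ho x"] by (simp add: ho_def)
        then show ?thesis using 1 by blast
      qed
      have "ho x = ho x'" using fx *(1-3) by metis
      then show "x = x'" using Ginj[of "ho x" x x' p] fx[OF *(1)] fx[OF *(2)] * VoNone None by auto
    qed
  next
    case (Some q)
    then obtain z c i where pq: "p = Some (z, c, i)" by (cases q) auto
    with p have z: "z \<in> U" and ci: "(c, i) \<in> ?B" by auto
    have oz: "hole z \<in> hole ` U" using z by simp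
    have pV: "p \<in> Vo (hole z)" using pq z ci VoSome by simp
    have inner: "f x p = G (hole z) x p \<and> f x p \<in> Vo (hole z)" if "x \<in> Vo (hole z)" "x \<noteq> p" for x
    proof -
      have "f x p = G (hole z) x p"
        using that by (cases x) (auto simp: f_def pq ho_def Vo_def H_def)
      then show ?thesis using Gmem[OF oz that(1) pV] that by auto
    qed
    have outer: "\<exists>y b e. x = Some (y, b, e) \<and> y \<in> U \<and> (b, e) \<in> ?B \<and> hole y \<noteq> hole z \<and>
        f x p = Some (M y z, (b - c) mod int w, (if z < M y z then e - i else e + 1 - i) mod int a)"
      if "x \<in> ?V" "x \<notin> Vo (hole z)" for x
    proof -
      from that VoNone obtain y b e where "x = Some (y, b, e)" "y \<in> U" "(b, e) \<in> ?B" by auto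
      moreover from this that VoSome have "hole y \<noteq> hole z" by auto
      ultimately show ?thesis by (auto simp: f_def pq ho_def pair_step_def)
    qed
    have outer_notin: "f x p \<notin> Vo (hole z)" if "x \<in> ?V" "x \<notin> Vo (hole z)" for x
      using outer[OF that] M[OF _ z] VoSome by (metis fst_conv)
    show ?thesis
    proof (rule inj_onI)
      fix x x' assume *: "x \<in> ?V - {p}" "x' \<in> ?V - {p}" "f x p = f x' p"
      \<comment> \<open>The target lies in the enlarged hole of \<open>p\<close> exactly when
        \<open>x\<close> does, so mixed cases cannot occur.\<close>
      consider "x \<in> Vo (hole z)" "x' \<in> Vo (hole z)" | "x \<notin> Vo (hole z)" "x' \<notin> Vo (hole z)"
        using inner outer_notin * by (metis DiffD1 DiffD2 singletonI)
      then show "x = x'"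
      proof cases
        case 1
        then show ?thesis using Ginj[OF oz 1 pV] inner[of x] inner[of x'] * by auto
      next
        case 2
        from outer[of x] 2 * obtain y b e where x: "x = Some (y, b, e)" "y \<in> U" "(b, e) \<in> ?B" "hole y \<noteq> hole z"
          "f x p = Some (M y z, (b - c) mod int w, (if z < M y z then e - i else e + 1 - i) mod int a)" by blast
        from outer[of x'] 2 * obtain y' b' e' where x': "x' = Some (y', b', e')" "y' \<in> U" "(b', e') \<in> ?B" "hole y' \<noteq> hole z"
          "f x' p = Some (M y' z, (b' - c) mod int w, (if z < M y' z then e' - i else e' + 1 - i) mod int a)" by blast
        \<comment> \<open>The block of the target gives \<open>y\<close> through the matchings; the
          other two coordinates then give \<open>b\<close> and \<open>e\<close>.\<close>
        have yy: "y = y'" using x x' *(3) M_inj[of y y' z] z by auto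
        have "(b - c) mod int w = (b' - c) mod int w" using x x' *(3) by simp
        then have "int w dvd b - b'" by (simp add: mod_eq_dvd_iff)
        then have bb: "b = b'" using x(3) x'(3) by (intro int_eq_if_dvd_diff) auto
        have "(if z < M y z then e - i else e + 1 - i) mod int a = (if z < M y z then e' - i else e' + 1 - i) mod int a"
          using x(5) x'(5) *(3) yy by simp
        then have "int a dvd e - e'" by (simp add: mod_eq_dvd_iff split: if_splits)
        then have "e = e'" using x(3) x'(3) by (intro int_eq_if_dvd_diff) auto
        then show ?thesis using x x' yy bb by simp
      qed
    qed
  qed
  ultimately have "near_cycle_system (2 * a) ?V f" unfolding near_cycle_system_def by blast
  then have "has_near_cycle_system (2 * a) (card ?V)"
    using has_near_cycle_system_iff[of ?V] U by blast
  then show ?thesis using cardV[OF U] by simp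
qed

section \<open>Two kinds of frames\<close>

text \<open>Holes are single points and the matchings are reflections modulo \<open>v\<close>. As
  \<open>v\<close> is odd, a reflection fixes only its centre and two points have exactly one
  midpoint.\<close>

lemma has_near_cycle_system_odd_frame:
  assumes a: "a > 0" and w: "w > 0" and v: "odd v"
    and fill: "has_near_cycle_system (2 * a) (w * a + 1)"
  shows "has_near_cycle_system (2 * a) (v * w * a + 1)"
proof -
  define M where "M y z = nat ((2 * int y - int z) mod int v)" for y z
  have v0: "v > 0" using v by (rule odd_pos)
  have half: "x = y" if "int v dvd 2 * (int x - int y)" "x < v" "y < v" for x y
  proof -
    have "int v dvd (int x - int y) * 2" using that(1) by (simp add: mult.commute)
    moreover have "coprime (int v) 2" using v by simp
    ultimately have "int v dvd int x - int y" using coprime_dvd_mult_left_iff by blast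
    then have "int x = int y" using that by (intro int_eq_if_dvd_diff) auto
    then show ?thesis by simp
  qed
  have iM: "int (M y z) = (2 * int y - int z) mod int v" for y z
    using v0 by (simp add: M_def)
  have M_less: "M y z < v" for y z using v0 by (simp add: M_def nat_less_iff)
  have "has_near_cycle_system (2 * a) (card {..<v} * w * a + 1)"
  proof (rule has_near_cycle_system_frame[where hole = "\<lambda>z. z" and M = M and k = 1])
    fix y z assume *: "y \<in> {..<v}" "z \<in> {..<v}" "z \<noteq> y"
    have "M y z \<noteq> y"
    proof
      assume "M y z = y"
      then have "(2 * int y - int z) mod int v = int y mod int v" using iM[of y z] * by simp
      then have "int v dvd int y - int z" by (simp add: mod_eq_dvd_iff algebra_simps)
      then have "int y = int z" using * by (intro int_eq_if_dvd_diff) auto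
      then show False using * by simp
    qed
    moreover have "M y z \<noteq> z"
    proof
      assume "M y z = z"
      then have "(2 * int y - int z) mod int v = int z mod int v" using iM[of y z] * by simp
      then have "int v dvd 2 * (int y - int z)" by (simp add: mod_eq_dvd_iff algebra_simps)
      then show False using half[of y z] * by simp
    qed
    moreover have "int (M y (M y z)) = int z"
      using * by (simp add: iM mod_simps)
    ultimately show "M y z \<in> {..<v} \<and> M y z \<noteq> y \<and> M y z \<noteq> z \<and> M y (M y z) = z"
      using M_less by simp
  next
    fix y y' z assume *: "y \<in> {..<v}" "y' \<in> {..<v}" "M y z = M y' z"
    then have "(2 * int y - int z) mod int v = (2 * int y' - int z) mod int v" using iM by metis
    then have "int v dvd 2 * (int y - int y')" by (simp add: mod_eq_dvd_iff algebra_simps)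
    then show "y = y'" using half[of y y'] * by simp
  next
    fix y assume "y \<in> {..<v}"
    then have "{z \<in> {..<v}. z = y} = {y}" by auto
    then show "card {z \<in> {..<v}. z = y} = 1" by simp
  qed (use a w fill in simp_all)
  then show ?thesis by simp
qed

text \<open>Swaps the members of each starter pair. Their differences, up to sign 1, 3 and 2, give
  every residue but 0 and 4 once. The entries at 0 and 4 are dummies, since these two form the
  hole.\<close>

definition starter_8 :: "nat \<Rightarrow> nat" where
  "starter_8 d = [0, 2, 1, 6, 0, 7, 3, 5] ! d"

text \<open>The starter translated by \<open>y\<close>; the added 8 keeps the natural subtraction
  from truncating for \<open>y < 8\<close>.\<close>

definition match_8 :: "nat \<Rightarrow> nat \<Rightarrow> nat" where
  "match_8 y z = (y + starter_8 ((z + 8 - y) mod 8)) mod 8"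

lemma match_8_frame:
  "\<forall>y\<in>set [0..<8]. \<forall>z\<in>set [0..<8]. z mod 4 \<noteq> y mod 4 \<longrightarrow>
     match_8 y z < 8 \<and> match_8 y z mod 4 \<noteq> y mod 4 \<and> match_8 y z mod 4 \<noteq> z mod 4 \<and> match_8 y (match_8 y z) = z"
  by code_simp

text \<open>The difference of \<open>match_8 y z\<close> and \<open>z\<close> modulo 8 determines
  \<open>z - y\<close>, as the starter differences are distinct. Points are listed so that
  evaluation decides the claim.\<close>

lemma match_8_inj:
  "\<forall>y\<in>set [0..<8]. \<forall>y'\<in>set [0..<8]. \<forall>z\<in>set [0..<8].
     y mod 4 \<noteq> z mod 4 \<longrightarrow> y' mod 4 \<noteq> z mod 4 \<longrightarrow> match_8 y z = match_8 y' z \<longrightarrow> y = y'"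
  by code_simp

lemma holes_8: "\<forall>y\<in>set [0..<8]. length (filter (\<lambda>z. z mod 4 = y mod 4) [0..<8]) = 2"
  by code_simp

lemma has_near_cycle_system_frame_8:
  assumes a: "a > 0" and w: "w > 0"
    and fill: "has_near_cycle_system (2 * a) (2 * w * a + 1)"
  shows "has_near_cycle_system (2 * a) (8 * w * a + 1)"
proof -
  have "has_near_cycle_system (2 * a) (card (set [0..<8]) * w * a + 1)"
  proof (rule has_near_cycle_system_frame[where hole = "\<lambda>z. z mod 4" and M = match_8 and k = 2])
    fix y z assume "y \<in> set [0..<8]" "z \<in> set [0..<8]" "z mod 4 \<noteq> y mod 4"
    then show "match_8 y z \<in> set [0..<8] \<and> match_8 y z mod 4 \<noteq> y mod 4 \<and>
        match_8 y z mod 4 \<noteq> z mod 4 \<and> match_8 y (match_8 y z) = z"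
      using match_8_frame by simp
  next
    fix y y' z assume "y \<in> set [0..<8]" "y' \<in> set [0..<8]" "z \<in> set [0..<8]"
      "y mod 4 \<noteq> z mod 4" "y' mod 4 \<noteq> z mod 4" "match_8 y z = match_8 y' z"
    then show "y = y'" using match_8_inj by blast
  next
    fix y assume y: "y \<in> set [0..<8]"
    have "{z \<in> set [0..<8]. z mod 4 = y mod 4} = set (filter (\<lambda>z. z mod 4 = y mod 4) [0..<8])" by auto
    then show "card {z \<in> set [0..<8]. z mod 4 = y mod 4} = 2"
      using holes_8 y distinct_card[of "filter (\<lambda>z. z mod 4 = y mod 4) [0..<8]"] by simp
  qed (use a w fill in simp_all)
  then show ?thesis by simp
qed

section \<open>Near cycle systems for all admissible orders\<close>

text \<open>By strong induction: an odd frame divides \<open>q\<close> by an odd factor, the frame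
  on eight points divides it by 4, and only \<open>q\<close> up to 2 remains. For
  \<open>a = 1\<close> the digons serve every \<open>q\<close>; the pair of cycles for
  \<open>q = 2\<close> requires \<open>a \<ge> 2\<close>.\<close>

lemma has_near_cycle_system_even:
  assumes a: "a > 0"
  shows "has_near_cycle_system (2 * a) (2 * a * q + 1)"
proof (cases "a = 1")
  case True
  then show ?thesis using has_near_cycle_system_2[of q] by simp
next
  case False
  with a have a2: "a \<ge> 2" by simp
  show ?thesis
  proof (induction q rule: less_induct)
    case (less q)
    have odd_step: ?case if q: "q = v * r" and v: "odd v" "v \<noteq> 1" and r: "r > 0" for v r
    proof -
      have "v > 1" using v odd_pos[of v] by simp
      then have "r < q" using q r by simp
      then have "has_near_cycle_system (2 * a) (2 * r * a + 1)"
        using less[of r] by (simp add: algebra_simps)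
      then have "has_near_cycle_system (2 * a) (v * (2 * r) * a + 1)"
        using has_near_cycle_system_odd_frame[of a "2 * r" v] a v r by simp
      then show ?thesis using q by (simp add: algebra_simps)
    qed
    consider "q = 0" | "q = 1" | "q = 2" | "odd q" "q \<noteq> 1" | r where "q = 2 * r" "odd r" "r \<noteq> 1"
      | r where "q = 4 * r" "r > 0"
    proof (cases "odd q \<or> q = 0")
      case False
      then obtain r where r: "q = 2 * r" "r > 0" by (auto elim: evenE)
      show ?thesis
      proof (cases "odd r")
        case True
        then show ?thesis using r that by (cases "r = 1") auto
      next
        case False
        then obtain r' where "r = 2 * r'" by (auto elim: evenE)
        then show ?thesis using r that(6)[of r'] by simp
      qed
    qed (use that in blast)
    then show ?case
    proof cases
      case 1
      \<comment> \<open>With a single point the only factor is empty, so any map serves.\<close>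
      have "near_cycle_system (2 * a) {..<1::nat} (\<lambda>x y. y)"
        by (simp add: near_cycle_system_def graded_cycles_def lessThan_Suc)
      then show ?thesis using 1 by (auto simp: has_near_cycle_system_def)
    next
      case 2
      then show ?thesis using has_near_cycle_system_base_1[OF a] by simp
    next
      case 3
      then show ?thesis using has_near_cycle_system_base_2[OF a2] by (simp add: mult.commute)
    next
      case 4
      then show ?thesis using odd_step[of q 1] by simp
    next
      case (5 r)
      then show ?thesis using odd_step[of r 2] by simp
    next
      case (6 r)
      then have "has_near_cycle_system (2 * a) (2 * r * a + 1)"
        using less[of r] by (simp add: algebra_simps)
      then show ?thesis using has_near_cycle_system_frame_8[of a r] a 6 by (simp add: algebra_simps)
    qed
  qed
qed

theorem theorem4p6:
  fixes k t i u g :: nat and p :: "nat \<Rightarrow> nat"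
  assumes "u > 0" and "g > 0"
    and "k = (\<Prod>j=1..t. p j)" and "k \<ge> 6" and "even k"
    and "\<And>j. j \<in> {1..t} \<Longrightarrow> prime (p j)"
    and "1 \<le> i" and "i < t - 1"
    and "\<exists>j\<in>{1..i}. p j = 2"
    and "\<And>j. j \<in> {i+1..t} \<Longrightarrow> odd (p j)"
    and "[u = 1] (mod (\<Prod>j=1..i. p j))"
    and "[g = 0] (mod (2 * (\<Prod>j=i+1..t. p j)))"
  shows "\<exists>Fs. is_ARCS k u g 2 Fs"
proof -
  define m where "m = (\<Prod>j=1..i. p j)"
  define n where "n = (\<Prod>j=i+1..t. p j)"
  have it: "i < t" using assms(8) by simp
  have "{1..t} = {1..i} \<union> {i+1..t}" using it by auto
  then have k: "k = m * n"
    unfolding assms(3) m_def n_def by (subst prod.union_disjoint[symmetric]) auto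
  have pos: "p j > 0" if "j \<in> {1..t}" for j using assms(6)[OF that] by (rule prime_gt_0_nat)
  have "2 dvd m" using assms(9) unfolding m_def by (metis dvd_prodI finite_atLeastAtMost)
  then obtain a where a: "m = 2 * a" by auto
  have "m > 0" unfolding m_def using pos it by (intro prod_pos) auto
  then have a0: "a > 0" using a by simp
  have n0: "n > 0" unfolding n_def using pos by (intro prod_pos) auto
  have n_odd: "odd n" unfolding n_def using assms(10) by (simp add: even_prod_iff)
  \<comment> \<open>Since \<open>i < t\<close>, the prime \<open>p t\<close> is a factor of
    \<open>n\<close>, which gives \<open>n > 1\<close>.\<close>
  have "p t dvd n" unfolding n_def using it by (intro dvd_prodI) auto
  moreover have "p t > 1" using prime_gt_1_nat[OF assms(6)[of t]] it by simp
  ultimately have n1: "n > 1" using n0 by (auto dest: dvd_imp_le)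
  have "m dvd u - 1" using assms(1,11) by (simp add: m_def cong_altdef_nat cong_sym_eq)
  then obtain q where "u - 1 = m * q" by auto
  then have u: "u = 2 * a * q + 1" using assms(1) a by simp
  have "2 * n dvd g" using assms(12) by (simp add: n_def cong_0_iff)
  then obtain r where "g = 2 * n * r" by auto
  \<comment> \<open>The lift is applied with \<open>h = 2 * r\<close>, positive because
    \<open>g > 0\<close>.\<close>
  then have g: "g = n * (2 * r)" "2 * r > 0" using assms(2) by auto
  obtain f where "near_cycle_system (2 * a) {..<u} f"
    using has_near_cycle_system_even[OF a0, of q] u by (auto simp: has_near_cycle_system_def)
  from is_ARCS_of_near_cycle_system[OF this a0 n_odd n1 g] show ?thesis using k a by simp
qed

end
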